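(* Suppose that $\mathcal J(\mathbf 1)<+\infty$ and that the convergence assumption, the source condition and the non-empty interior assumption (all stated in the context) hold. Let $(\lambda_n,\mu_n)$ be a solution of the dual problem $$\max_{\lambda\geq0,\ \mu\geq0}\ (\mu,-\phi_n)\quad\text{s.t. }\lambda-B_n^*\mu\in\partial\mathcal J(0).$$ Then $\|\lambda_n\|_{1}\leq C$ for a constant $C$ independent of $n$, where $\|\lambda_n\|_1$ is the $L^1$ norm of $\lambda_n$.
   Context: $\Omega\subset\mathbb R^m$ is a bounded domain, $L^1=L^1(\Omega)$, $L^\infty=L^\infty(\Omega)$, $\mathbf 1$ is the constant function one, and $(\cdot,\cdot)$ denotes duality pairings (between $L^1$ and $L^\infty$, and between $L^\infty$ and $(L^\infty)^*$). Functions are ordered a.e. pointwise; for regular linear operators $L^1\to L^\infty$ (differences of two positive operators), $S\geq T$ means that $(S-T)u\geq0$ for all $u\geq 0$; $\mu\in(L^\infty)^*$ satisfies $\mu\geq0$ iff $(\mu,\psi)\geq0$ for all $0\leq\psi\in L^\infty$; pairs are ordered componentwise and an inequality between a pair and a scalar function is meant componentwise. $A\colon L^1\to L^\infty$ is a linear operator and $f\in L^\infty$. Sequences of bounds satisfy $f^l_n\leq f\leq f^u_n$, $f^l_{n+1}\geq f^l_n$, $f^u_{n+1}\leq f^u_n$, $A^l_n\leq A\leq A^u_n$, $A^l_{n+1}\geq A^l_n$, $A^u_{n+1}\leq A^u_n$, $\|f^u_n-f^l_n\|_\infty\to0$, $\|A^u_n-A^l_n\|\to0$. Put $B_nu=(A^l_nu,-A^u_nu)$,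 $\phi_n=(f^u_n,-f^l_n)$, $\bar Bu=(Au,-Au)$, $\bar\phi=(f,-f)$. In dual problems $\lambda\in L^\infty$, $\mu\in(L^\infty)^*\times(L^\infty)^*$, and $B_n^*,\bar B^*\colon(L^\infty)^*\times(L^\infty)^*\to L^\infty$ are the adjoints. $\mathcal J\colon L^1\to[0,\infty]$ is convex, proper and absolutely one-homogeneous. $\partial\mathcal J(u)=\{p\in L^\infty:\ \mathcal J(v)\geq(p,v)\ \forall v\in L^1,\ \mathcal J(u)=(p,u)\}$, so $\partial\mathcal J(0)=\{p\in L^\infty:\mathcal J(v)\geq(p,v)\ \forall v\in L^1\}$. Standing assumption: $Au=f$ has a non-negative solution with finite $\mathcal J$, and $\bar u_{\mathcal J}$ denotes a $\mathcal J$-minimising solution, i.e. a minimiser of $\mathcal J(u)$ over $u\in L^1$, $u\geq0$, $Au=f$. Convergence assumption: there are sequences $\varepsilon_n\downarrow0$, $\eta_n\downarrow0$ and constants $C_0\geq1$, $D_0>0$ with $\varepsilon_n\mathbf 1\leq\phi_n-\bar\phi\leq C_0\varepsilon_n\mathbf 1$, $\|\bar B-B_n\|_{L^1\to L^\infty}\leq\eta_n$, and $\limsup_{n\to\infty}\eta_n/\varepsilon_n\leq D_0$. Source condition: there exists $\bar\mu\in(L^\infty)^*\times(L^\infty)^*$, $\bar\mu\geq0$, with $-\bar B^*\bar\mu\in\partial\mathcal J(\bar u_{\mathcal J})$. Non-empty interior assumption: $0$ is an interior point of $\partial\mathcal J(0)$ in the norm topology of $L^\infty$. *)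

theory Defs
  imports "HOL-Analysis.Analysis" "HOL-Probability.Essential_Supremum"
begin

text \<open>
  Elements of \<open>L\<^sup>1(\<Omega>)\<close> and \<open>L\<^sup>\<infinity>(\<Omega>)\<close> are handled through representatives: real functions
  on the ambient space, of which only the restriction to \<open>\<Omega>\<close> matters. Equality and order are
  understood almost everywhere on \<open>\<Omega>\<close>, and operators and functionals are required to respect
  almost-everywhere equality.
\<close>

type_synonym 'm fn = "real ^ 'm \<Rightarrow> real"
type_synonym 'm functional = "'m fn \<Rightarrow> real"

definition domain_set :: "(real ^ 'm) set \<Rightarrow> bool" where
  "domain_set \<Omega> \<longleftrightarrow> open \<Omega> \<and> connected \<Omega> \<and> \<Omega> \<noteq> {}"

definition ae_eq :: "(real ^ 'm) set \<Rightarrow> 'm fn \<Rightarrow> 'm fn \<Rightarrow> bool" where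
  "ae_eq \<Omega> u v \<longleftrightarrow> (AE x in lebesgue_on \<Omega>. u x = v x)"

definition ae_le :: "(real ^ 'm) set \<Rightarrow> 'm fn \<Rightarrow> 'm fn \<Rightarrow> bool" where
  "ae_le \<Omega> u v \<longleftrightarrow> (AE x in lebesgue_on \<Omega>. u x \<le> v x)"

definition pair_le :: "(real ^ 'm) set \<Rightarrow> 'm fn \<times> 'm fn \<Rightarrow> 'm fn \<times> 'm fn \<Rightarrow> bool" where
  "pair_le \<Omega> \<phi> \<psi> \<longleftrightarrow> ae_le \<Omega> (fst \<phi>) (fst \<psi>) \<and> ae_le \<Omega> (snd \<phi>) (snd \<psi>)"

definition const_pair :: "real \<Rightarrow> 'm fn \<times> 'm fn" where
  "const_pair c = ((\<lambda>_. c), (\<lambda>_. c))"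


definition L1 :: "(real ^ 'm) set \<Rightarrow> 'm fn set" where
  "L1 \<Omega> = {u. integrable (lebesgue_on \<Omega>) u}"

definition L1_norm :: "(real ^ 'm) set \<Rightarrow> 'm fn \<Rightarrow> ennreal" where
  "L1_norm \<Omega> u = (\<integral>\<^sup>+ x. ennreal \<bar>u x\<bar> \<partial>lebesgue_on \<Omega>)"

definition Linf_norm :: "(real ^ 'm) set \<Rightarrow> 'm fn \<Rightarrow> ennreal" where
  "Linf_norm \<Omega> p = esssup (lebesgue_on \<Omega>) (\<lambda>x. ennreal \<bar>p x\<bar>)"

definition Linf :: "(real ^ 'm) set \<Rightarrow> 'm fn set" where
  "Linf \<Omega> = {p \<in> borel_measurable (lebesgue_on \<Omega>). Linf_norm \<Omega> p < \<infinity>}"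

definition Linf_pair_norm :: "(real ^ 'm) set \<Rightarrow> 'm fn \<times> 'm fn \<Rightarrow> ennreal" where
  "Linf_pair_norm \<Omega> \<psi> = max (Linf_norm \<Omega> (fst \<psi>)) (Linf_norm \<Omega> (snd \<psi>))"

definition pairing :: "(real ^ 'm) set \<Rightarrow> 'm fn \<Rightarrow> 'm fn \<Rightarrow> real" where
  "pairing \<Omega> p u = (\<integral>x. p x * u x \<partial>lebesgue_on \<Omega>)"


text \<open>
  The dual of \<open>L\<^sup>\<infinity>(\<Omega>)\<close>. The values of a functional outside \<open>Linf \<Omega>\<close> are irrelevant; invariance
  under almost-everywhere equality follows from linearity and boundedness.
\<close>

definition Linf_dual :: "(real ^ 'm) set \<Rightarrow> 'm functional set" where
  "Linf_dual \<Omega> = {\<mu>.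
     (\<forall>\<psi>\<in>Linf \<Omega>. \<forall>\<psi>'\<in>Linf \<Omega>. \<forall>a b. \<mu> (\<lambda>x. a * \<psi> x + b * \<psi>' x) = a * \<mu> \<psi> + b * \<mu> \<psi>') \<and>
     (\<exists>c. \<forall>\<psi>\<in>Linf \<Omega>. \<bar>\<mu> \<psi>\<bar> \<le> c * enn2real (Linf_norm \<Omega> \<psi>))}"

definition dual_nonneg :: "(real ^ 'm) set \<Rightarrow> 'm functional \<Rightarrow> bool" where
  "dual_nonneg \<Omega> \<mu> \<longleftrightarrow> (\<forall>\<psi>\<in>Linf \<Omega>. ae_le \<Omega> (\<lambda>_. 0) \<psi> \<longrightarrow> 0 \<le> \<mu> \<psi>)"

definition dual_pair_nonneg :: "(real ^ 'm) set \<Rightarrow> 'm functional \<times> 'm functional \<Rightarrow> bool" where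
  "dual_pair_nonneg \<Omega> \<mu> \<longleftrightarrow> dual_nonneg \<Omega> (fst \<mu>) \<and> dual_nonneg \<Omega> (snd \<mu>)"

definition dual_pairing :: "'m functional \<times> 'm functional \<Rightarrow> 'm fn \<times> 'm fn \<Rightarrow> real" where
  "dual_pairing \<mu> \<psi> = fst \<mu> (fst \<psi>) + snd \<mu> (snd \<psi>)"


definition linear_op :: "(real ^ 'm) set \<Rightarrow> ('m fn \<Rightarrow> 'm fn) \<Rightarrow> bool" where
  "linear_op \<Omega> T \<longleftrightarrow>
     (\<forall>u\<in>L1 \<Omega>. T u \<in> Linf \<Omega>) \<and>
     (\<forall>u\<in>L1 \<Omega>. \<forall>v\<in>L1 \<Omega>. ae_eq \<Omega> u v \<longrightarrow> ae_eq \<Omega> (T u) (T v)) \<and>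
     (\<forall>u\<in>L1 \<Omega>. \<forall>v\<in>L1 \<Omega>. \<forall>a b.
        ae_eq \<Omega> (T (\<lambda>x. a * u x + b * v x)) (\<lambda>x. a * T u x + b * T v x))"

definition op_le :: "(real ^ 'm) set \<Rightarrow> ('m fn \<Rightarrow> 'm fn) \<Rightarrow> ('m fn \<Rightarrow> 'm fn) \<Rightarrow> bool" where
  "op_le \<Omega> T S \<longleftrightarrow> (\<forall>u\<in>L1 \<Omega>. ae_le \<Omega> (\<lambda>_. 0) u \<longrightarrow> ae_le \<Omega> (\<lambda>_. 0) (S u - T u))"

definition positive_op :: "(real ^ 'm) set \<Rightarrow> ('m fn \<Rightarrow> 'm fn) \<Rightarrow> bool" where
  "positive_op \<Omega> T \<longleftrightarrow> linear_op \<Omega> T \<and>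
     (\<forall>u\<in>L1 \<Omega>. ae_le \<Omega> (\<lambda>_. 0) u \<longrightarrow> ae_le \<Omega> (\<lambda>_. 0) (T u))"

definition regular_op :: "(real ^ 'm) set \<Rightarrow> ('m fn \<Rightarrow> 'm fn) \<Rightarrow> bool" where
  "regular_op \<Omega> T \<longleftrightarrow> linear_op \<Omega> T \<and>
     (\<exists>P Q. positive_op \<Omega> P \<and> positive_op \<Omega> Q \<and> (\<forall>u\<in>L1 \<Omega>. ae_eq \<Omega> (T u) (P u - Q u)))"

definition op_norm :: "(real ^ 'm) set \<Rightarrow> ('m fn \<Rightarrow> 'm fn) \<Rightarrow> ennreal" where
  "op_norm \<Omega> T = (SUP u\<in>{u\<in>L1 \<Omega>. L1_norm \<Omega> u \<le> 1}. Linf_norm \<Omega> (T u))"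

definition op_pair_norm :: "(real ^ 'm) set \<Rightarrow> ('m fn \<Rightarrow> 'm fn \<times> 'm fn) \<Rightarrow> ennreal" where
  "op_pair_norm \<Omega> B = (SUP u\<in>{u\<in>L1 \<Omega>. L1_norm \<Omega> u \<le> 1}. Linf_pair_norm \<Omega> (B u))"

text \<open>
  The adjoint of \<open>B : L\<^sup>1 \<rightarrow> L\<^sup>\<infinity> \<times> L\<^sup>\<infinity>\<close>, as a map \<open>(L\<^sup>\<infinity>)\<^sup>* \<times> (L\<^sup>\<infinity>)\<^sup>* \<rightarrow> (L\<^sup>1)\<^sup>* = L\<^sup>\<infinity>\<close>.
  For bounded \<open>B\<close> (in particular when both components are regular) the chosen function exists
  by Riesz representation of \<open>(L\<^sup>1)\<^sup>*\<close>, and it is unique up to almost-everywhere equality.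
\<close>

definition adjoint_op ::
  "(real ^ 'm) set \<Rightarrow> ('m fn \<Rightarrow> 'm fn \<times> 'm fn) \<Rightarrow> 'm functional \<times> 'm functional \<Rightarrow> 'm fn" where
  "adjoint_op \<Omega> B \<mu> = (SOME w. w \<in> Linf \<Omega> \<and> (\<forall>u\<in>L1 \<Omega>. pairing \<Omega> w u = dual_pairing \<mu> (B u)))"


definition L1_functional :: "(real ^ 'm) set \<Rightarrow> ('m fn \<Rightarrow> ereal) \<Rightarrow> bool" where
  "L1_functional \<Omega> J \<longleftrightarrow>
     (\<forall>u\<in>L1 \<Omega>. 0 \<le> J u) \<and> (\<forall>u\<in>L1 \<Omega>. \<forall>v\<in>L1 \<Omega>. ae_eq \<Omega> u v \<longrightarrow> J u = J v)"

definition convex_functional :: "(real ^ 'm) set \<Rightarrow> ('m fn \<Rightarrow> ereal) \<Rightarrow> bool" where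
  "convex_functional \<Omega> J \<longleftrightarrow>
     (\<forall>u\<in>L1 \<Omega>. \<forall>v\<in>L1 \<Omega>. \<forall>t::real. 0 \<le> t \<and> t \<le> 1 \<longrightarrow>
        J (\<lambda>x. t * u x + (1 - t) * v x) \<le> ereal t * J u + ereal (1 - t) * J v)"

definition proper_functional :: "(real ^ 'm) set \<Rightarrow> ('m fn \<Rightarrow> ereal) \<Rightarrow> bool" where
  "proper_functional \<Omega> J \<longleftrightarrow> (\<exists>u\<in>L1 \<Omega>. J u < \<infinity>)"

text \<open>With the convention \<open>0 * \<infinity> = 0\<close> of \<^typ>\<open>ereal\<close>, the case \<open>c = 0\<close> says that \<open>J\<close> vanishes at \<open>0\<close>.\<close>

definition abs_one_homogeneous :: "(real ^ 'm) set \<Rightarrow> ('m fn \<Rightarrow> ereal) \<Rightarrow> bool" where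
  "abs_one_homogeneous \<Omega> J \<longleftrightarrow>
     (\<forall>u\<in>L1 \<Omega>. \<forall>c::real. J (\<lambda>x. c * u x) = ereal \<bar>c\<bar> * J u)"

definition subdiff :: "(real ^ 'm) set \<Rightarrow> ('m fn \<Rightarrow> ereal) \<Rightarrow> 'm fn \<Rightarrow> 'm fn set" where
  "subdiff \<Omega> J u = {p \<in> Linf \<Omega>.
     (\<forall>v\<in>L1 \<Omega>. J v \<ge> ereal (pairing \<Omega> p v)) \<and> J u = ereal (pairing \<Omega> p u)}"

definition nonneg_solution ::
  "(real ^ 'm) set \<Rightarrow> ('m fn \<Rightarrow> 'm fn) \<Rightarrow> 'm fn \<Rightarrow> 'm fn \<Rightarrow> bool" where
  "nonneg_solution \<Omega> A f u \<longleftrightarrow> u \<in> L1 \<Omega> \<and> ae_le \<Omega> (\<lambda>_. 0) u \<and> ae_eq \<Omega> (A u) f"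

definition J_minimising_solution ::
  "(real ^ 'm) set \<Rightarrow> ('m fn \<Rightarrow> ereal) \<Rightarrow> ('m fn \<Rightarrow> 'm fn) \<Rightarrow> 'm fn \<Rightarrow> 'm fn \<Rightarrow> bool" where
  "J_minimising_solution \<Omega> J A f u \<longleftrightarrow>
     nonneg_solution \<Omega> A f u \<and> (\<forall>v. nonneg_solution \<Omega> A f v \<longrightarrow> J u \<le> J v)"


definition bound_op :: "('m fn \<Rightarrow> 'm fn) \<Rightarrow> ('m fn \<Rightarrow> 'm fn) \<Rightarrow> 'm fn \<Rightarrow> 'm fn \<times> 'm fn" where
  "bound_op Al Au u = (Al u, - Au u)"

definition bound_rhs :: "'m fn \<Rightarrow> 'm fn \<Rightarrow> 'm fn \<times> 'm fn" where
  "bound_rhs fl fu = (fu, - fl)"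

definition rhs_bounds :: "(real ^ 'm) set \<Rightarrow> 'm fn \<Rightarrow> (nat \<Rightarrow> 'm fn) \<Rightarrow> (nat \<Rightarrow> 'm fn) \<Rightarrow> bool" where
  "rhs_bounds \<Omega> f fl fu \<longleftrightarrow>
     (\<forall>n. fl n \<in> Linf \<Omega> \<and> fu n \<in> Linf \<Omega> \<and>
          ae_le \<Omega> (fl n) f \<and> ae_le \<Omega> f (fu n) \<and>
          ae_le \<Omega> (fl n) (fl (Suc n)) \<and> ae_le \<Omega> (fu (Suc n)) (fu n)) \<and>
     (\<lambda>n. Linf_norm \<Omega> (fu n - fl n)) \<longlonglongrightarrow> 0"

definition op_bounds ::
  "(real ^ 'm) set \<Rightarrow> ('m fn \<Rightarrow> 'm fn) \<Rightarrow> (nat \<Rightarrow> 'm fn \<Rightarrow> 'm fn) \<Rightarrow> (nat \<Rightarrow> 'm fn \<Rightarrow> 'm fn) \<Rightarrow> bool" where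
  "op_bounds \<Omega> A Al Au \<longleftrightarrow>
     (\<forall>n. regular_op \<Omega> (Al n) \<and> regular_op \<Omega> (Au n) \<and>
          op_le \<Omega> (Al n) A \<and> op_le \<Omega> A (Au n) \<and>
          op_le \<Omega> (Al n) (Al (Suc n)) \<and> op_le \<Omega> (Au (Suc n)) (Au n)) \<and>
     (\<lambda>n. op_norm \<Omega> (\<lambda>u. Au n u - Al n u)) \<longlonglongrightarrow> 0"

definition convergence_assumption ::
  "(real ^ 'm) set \<Rightarrow> ('m fn \<Rightarrow> 'm fn \<times> 'm fn) \<Rightarrow> (nat \<Rightarrow> 'm fn \<Rightarrow> 'm fn \<times> 'm fn) \<Rightarrow>
   'm fn \<times> 'm fn \<Rightarrow> (nat \<Rightarrow> 'm fn \<times> 'm fn) \<Rightarrow> bool" where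
  "convergence_assumption \<Omega> Bbar B \<phi>bar \<phi> \<longleftrightarrow>
     (\<exists>(\<epsilon>::nat \<Rightarrow> real) (\<eta>::nat \<Rightarrow> real) (C0::real) (D0::real).
        (\<forall>n. 0 < \<epsilon> n) \<and> decseq \<epsilon> \<and> \<epsilon> \<longlonglongrightarrow> 0 \<and>
        decseq \<eta> \<and> \<eta> \<longlonglongrightarrow> 0 \<and>
        1 \<le> C0 \<and> 0 < D0 \<and>
        (\<forall>n. pair_le \<Omega> (const_pair (\<epsilon> n)) (\<phi> n - \<phi>bar) \<and>
             pair_le \<Omega> (\<phi> n - \<phi>bar) (const_pair (C0 * \<epsilon> n))) \<and>
        (\<forall>n. op_pair_norm \<Omega> (\<lambda>u. Bbar u - B n u) \<le> ennreal (\<eta> n)) \<and>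
        limsup (\<lambda>n. ereal (\<eta> n / \<epsilon> n)) \<le> ereal D0)"

definition source_condition ::
  "(real ^ 'm) set \<Rightarrow> ('m fn \<Rightarrow> ereal) \<Rightarrow> ('m fn \<Rightarrow> 'm fn \<times> 'm fn) \<Rightarrow> 'm fn \<Rightarrow> bool" where
  "source_condition \<Omega> J Bbar ubar \<longleftrightarrow>
     (\<exists>\<mu>bar \<in> Linf_dual \<Omega> \<times> Linf_dual \<Omega>. dual_pair_nonneg \<Omega> \<mu>bar \<and>
        - adjoint_op \<Omega> Bbar \<mu>bar \<in> subdiff \<Omega> J ubar)"

definition nonempty_interior_assumption :: "(real ^ 'm) set \<Rightarrow> ('m fn \<Rightarrow> ereal) \<Rightarrow> bool" where
  "nonempty_interior_assumption \<Omega> J \<longleftrightarrow>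
     (\<exists>r::real. 0 < r \<and> {p \<in> Linf \<Omega>. Linf_norm \<Omega> p < ennreal r} \<subseteq> subdiff \<Omega> J (\<lambda>_. 0))"

definition dual_feasible ::
  "(real ^ 'm) set \<Rightarrow> ('m fn \<Rightarrow> ereal) \<Rightarrow> ('m fn \<Rightarrow> 'm fn \<times> 'm fn) \<Rightarrow>
   'm fn \<Rightarrow> 'm functional \<times> 'm functional \<Rightarrow> bool" where
  "dual_feasible \<Omega> J B lam \<mu> \<longleftrightarrow>
     lam \<in> Linf \<Omega> \<and> ae_le \<Omega> (\<lambda>_. 0) lam \<and>
     \<mu> \<in> Linf_dual \<Omega> \<times> Linf_dual \<Omega> \<and> dual_pair_nonneg \<Omega> \<mu> \<and>
     lam - adjoint_op \<Omega> B \<mu> \<in> subdiff \<Omega> J (\<lambda>_. 0)"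

definition dual_solution ::
  "(real ^ 'm) set \<Rightarrow> ('m fn \<Rightarrow> ereal) \<Rightarrow> ('m fn \<Rightarrow> 'm fn \<times> 'm fn) \<Rightarrow> 'm fn \<times> 'm fn \<Rightarrow>
   'm fn \<Rightarrow> 'm functional \<times> 'm functional \<Rightarrow> bool" where
  "dual_solution \<Omega> J B \<phi> lam \<mu> \<longleftrightarrow>
     dual_feasible \<Omega> J B lam \<mu> \<and>
     (\<forall>lam' \<mu>'. dual_feasible \<Omega> J B lam' \<mu>' \<longrightarrow>
        dual_pairing \<mu>' (- \<phi>) \<le> dual_pairing \<mu> (- \<phi>))"

end

theory Submission
  imports Defs
begin

text \<open>
  The argument bounds first the total mass \<open>(\<mu>\<^sub>n, 1)\<close> of the multipliers, which is their norm because
  they are non-negative, and then derives the bound on \<open>\<lambda>\<^sub>n\<close> from it.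

  For the multipliers, write \<open>u\<close> for the minimising solution and \<open>\<mu>\<close> for the multiplier of the source
  condition. Since \<open>\<lambda>\<^sub>n \<ge> 0\<close>, \<open>u \<ge> 0\<close> and \<open>B\<^sub>n u \<le> (A u, - A u)\<close>, feasibility of \<open>(\<lambda>\<^sub>n, \<mu>\<^sub>n)\<close> gives
  \<open>- J(u) \<le> (\<mu>\<^sub>n, B\<^sub>n u) \<le> (\<mu>\<^sub>n, (f, - f))\<close>, hence
  \<open>(\<mu>\<^sub>n, \<phi>\<^sub>n) \<ge> \<epsilon>\<^sub>n (\<mu>\<^sub>n, 1) - J(u)\<close>. An upper bound for \<open>(\<mu>\<^sub>n, \<phi>\<^sub>n)\<close> comes from optimality, once a
  competitor is available. The pair \<open>(0, \<mu>)\<close> itself need not be feasible: passing from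
  the exact operator to \<open>B\<^sub>n\<close> shifts \<open>- Bbar\<^sup>* \<mu>\<close> by \<open>(Bbar - B\<^sub>n)\<^sup>* \<mu>\<close>, whose \<open>L\<^sup>\<infinity>\<close> norm is at most \<open>\<eta>\<^sub>n (\<mu>, 1)\<close>. The interior assumption is
  the same as coercivity \<open>J(v) \<ge> \<rho> \<parallel>v\<parallel>\<close> in \<open>L\<^sup>1\<close> (\<open>interior_coercive\<close> is the direction that is used),
  and it makes \<open>(0, c\<^sub>n \<mu>)\<close> feasible for a factor with \<open>1 - c\<^sub>n = O(\<eta>\<^sub>n)\<close>
  (\<open>scaled_multiplier_feasible\<close>). As \<open>(\<mu>, (f, - f)) = - J(u)\<close> by the source condition, the terms of
  order one cancel and \<open>\<epsilon>\<^sub>n (\<mu>\<^sub>n, 1) = O(\<epsilon>\<^sub>n + \<eta>\<^sub>n)\<close> remains (\<open>dual_solution_mass_bound\<close>); the ratio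
  \<open>\<eta>\<^sub>n / \<epsilon>\<^sub>n\<close> is bounded.

  Finally, testing feasibility with the constant function 1 gives
  \<open>\<parallel>\<lambda>\<^sub>n\<parallel> \<le> J(1) + (\<mu>\<^sub>n, B\<^sub>n 1) \<le> J(1) + (\<mu>\<^sub>n, (A 1, - A 1)) \<le> J(1) + \<parallel>A 1\<parallel> (\<mu>\<^sub>n, 1)\<close>, with the \<open>L\<^sup>\<infinity>\<close>
  norm of \<open>A 1\<close>.

  All of this uses that \<open>B\<^sub>n\<^sup>* \<mu>\<^sub>n\<close> really is a function in \<open>L\<^sup>\<infinity>\<close> that represents \<open>u \<mapsto> (\<mu>\<^sub>n, B\<^sub>n u)\<close>.
  This is the part of the duality \<open>(L\<^sup>1)\<^sup>* = L\<^sup>\<infinity>\<close> that is needed. It holds because a positive functional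
  on \<open>L\<^sup>1\<close> is automatically bounded and thus, by Radon-Nikodym, has an essentially bounded density
  (\<open>positive_functional_density\<close>), and because the operators are differences of positive ones.
\<close>

section \<open>Positive functionals on integrable functions\<close>

definition positive_functional :: "'a measure \<Rightarrow> (('a \<Rightarrow> real) \<Rightarrow> real) \<Rightarrow> bool" where
  "positive_functional M F \<longleftrightarrow>
     (\<forall>u v a b. integrable M u \<longrightarrow> integrable M v \<longrightarrow>
        F (\<lambda>x. a * u x + b * v x) = a * F u + b * F v) \<and>
     (\<forall>u. integrable M u \<longrightarrow> (AE x in M. 0 \<le> u x) \<longrightarrow> 0 \<le> F u)"

lemma positive_functional_lin:
  assumes "positive_functional M F" "integrable M u" "integrable M v"
  shows "F (\<lambda>x. a * u x + b * v x) = a * F u + b * F v"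
  using assms unfolding positive_functional_def by blast

lemma positive_functional_scale:
  assumes "positive_functional M F" "integrable M u"
  shows "F (\<lambda>x. a * u x) = a * F u"
  using positive_functional_lin[OF assms assms(2), of a 0] by simp

lemma positive_functional_diff:
  assumes "positive_functional M F" "integrable M u" "integrable M v"
  shows "F (\<lambda>x. u x - v x) = F u - F v"
  using positive_functional_lin[OF assms, of 1 "-1"] by simp

lemma positive_functional_mono:
  assumes "positive_functional M F" "integrable M u" "integrable M v" "AE x in M. u x \<le> v x"
  shows "F u \<le> F v"
proof -
  have "0 \<le> F (\<lambda>x. v x - u x)"
    using assms unfolding positive_functional_def by auto
  then show ?thesis
    using positive_functional_diff[OF assms(1,3,2)] by simp
qed

lemma positive_functional_sum:
  assumes "positive_functional M F" "\<And>k. integrable M (v k)"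
  shows "F (\<lambda>x. \<Sum>k<N. v k x) = (\<Sum>k<N::nat. F (v k))"
proof (induction N)
  case 0
  show ?case using positive_functional_scale[OF assms(1,2), of 0] by simp
next
  case (Suc N)
  have "F (\<lambda>x. 1 * (\<Sum>k<N. v k x) + 1 * v N x) = 1 * F (\<lambda>x. \<Sum>k<N. v k x) + 1 * F (v N)"
    by (rule positive_functional_lin[OF assms(1)]) (auto simp: assms(2))
  with Suc show ?case by simp
qed

text \<open>
  If \<open>F\<close> were unbounded on the positive cone, there would be non-negative
  \<open>v k\<close> with integral at most \<open>(1/2)^k\<close> but \<open>F (v k) = 1\<close>. Their sum is integrable and dominates every
  partial sum, so by monotonicity its image under \<open>F\<close> would exceed every natural number. This is the
  source of all boundedness of regular operators below.
\<close>

lemma positive_functional_bounded: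
  assumes F: "positive_functional M F"
  obtains K where "0 \<le> K" "\<And>u. integrable M u \<Longrightarrow> \<bar>F u\<bar> \<le> K * (\<integral>x. \<bar>u x\<bar> \<partial>M)"
proof -
  have "\<exists>K\<ge>0. \<forall>u. integrable M u \<longrightarrow> (AE x in M. 0 \<le> u x) \<longrightarrow> F u \<le> K * (\<integral>x. u x \<partial>M)"
  proof (rule ccontr)
    assume contr: "\<not> ?thesis"
    have "\<exists>v. integrable M v \<and> (AE x in M. 0 \<le> v x) \<and> (\<integral>x. v x \<partial>M) \<le> (1/2)^k \<and> F v = 1" for k :: nat
    proof -
      obtain u where u: "integrable M u" "AE x in M. 0 \<le> u x" "2^k * (\<integral>x. u x \<partial>M) < F u"
        using contr by (metis not_le zero_le_power zero_le_numeral)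
      have nn: "0 \<le> (\<integral>x. u x \<partial>M)" using u(2) by (rule integral_nonneg_AE)
      then have pos: "0 < F u" using u(3) by (meson le_less_trans mult_nonneg_nonneg zero_le_numeral zero_le_power)
      let ?v = "\<lambda>x. inverse (F u) * u x"
      have "F ?v = 1" using positive_functional_scale[OF F u(1)] pos by simp
      moreover have "(\<integral>x. ?v x \<partial>M) \<le> (1/2)^k"
        using u(1,3) pos by (simp add: field_simps power_divide)
      moreover have "AE x in M. 0 \<le> ?v x" using u(2) pos by auto
      ultimately show ?thesis using u(1) by (intro exI[of _ ?v]) auto
    qed
    then obtain v where v: "\<And>k. integrable M (v k)" "\<And>k. AE x in M. 0 \<le> v k x"
      "\<And>k. (\<integral>x. v k x \<partial>M) \<le> (1/2)^k" "\<And>k::nat. F (v k) = 1" by metis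
    have [measurable]: "v k \<in> borel_measurable M" for k using v(1) by auto
    define g where "g x = (\<Sum>k. ennreal (v k x))" for x
    have [measurable]: "g \<in> borel_measurable M" unfolding g_def by measurable
    have "(\<integral>\<^sup>+x. g x \<partial>M) = (\<Sum>k. \<integral>\<^sup>+x. ennreal (v k x) \<partial>M)"
      unfolding g_def by (rule nn_integral_suminf) auto
    also have "\<dots> = (\<Sum>k. ennreal (\<integral>x. v k x \<partial>M))"
      by (simp add: nn_integral_eq_integral v(1,2))
    also have "\<dots> \<le> (\<Sum>k. ennreal ((1/2)^k))"
      by (intro suminf_le) (auto intro!: ennreal_leI v(3) simp: summableI)
    also have "\<dots> = ennreal (\<Sum>k. (1/2)^k)" by (intro suminf_ennreal2) auto
    finally have gfin: "(\<integral>\<^sup>+x. g x \<partial>M) < \<infinity>" using le_less_trans ennreal_less_top by (metis infinity_ennreal_def)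
    then have gAE: "AE x in M. g x \<noteq> \<infinity>" by (intro nn_integral_PInf_AE) auto
    \<comment> \<open>The pointwise sum may be infinite on a null set, where the conversion to \<open>real\<close> yields 0.\<close>
    let ?S = "\<lambda>x. enn2real (g x)"
    have S: "integrable M ?S"
    proof (rule integrableI_nonneg)
      have "(\<integral>\<^sup>+x. ennreal (?S x) \<partial>M) \<le> (\<integral>\<^sup>+x. g x \<partial>M)"
        by (intro nn_integral_mono) (simp add: ennreal_enn2real_if)
      then show "(\<integral>\<^sup>+x. ennreal (?S x) \<partial>M) < \<infinity>" using gfin by (rule le_less_trans)
    qed auto
    have "real N \<le> F ?S" for N
    proof -
      have vall: "AE x in M. \<forall>k. 0 \<le> v k x" using v(2) by (simp add: AE_all_countable)
      have "AE x in M. (\<Sum>k<N. v k x) \<le> ?S x"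
        using gAE vall
      proof eventually_elim
        case (elim x)
        have "ennreal (\<Sum>k<N. v k x) = (\<Sum>k<N. ennreal (v k x))" using elim by (simp add: sum_ennreal)
        also have "\<dots> \<le> g x" unfolding g_def by (intro sum_le_suminf) (auto simp: summableI)
        finally show ?case using elim(1)
          by (metis elim(2) enn2real_ennreal enn2real_mono sum_nonneg ennreal_less_top infinity_ennreal_def top.not_eq_extremum)
      qed
      then have "F (\<lambda>x. \<Sum>k<N. v k x) \<le> F ?S"
        by (intro positive_functional_mono[OF F _ S]) (auto simp: v(1))
      then show ?thesis by (simp add: positive_functional_sum[OF F v(1)] v(4))
    qed
    then show False using reals_Archimedean2 not_le by blast
  qed
  then obtain K where K: "0 \<le> K"
    "\<And>u. integrable M u \<Longrightarrow> AE x in M. 0 \<le> u x \<Longrightarrow> F u \<le> K * (\<integral>x. u x \<partial>M)" by blast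
  have "\<bar>F u\<bar> \<le> K * (\<integral>x. \<bar>u x\<bar> \<partial>M)" if u: "integrable M u" for u
  proof -
    have "F u \<le> F (\<lambda>x. \<bar>u x\<bar>)" by (intro positive_functional_mono[OF F]) (auto simp: u)
    moreover have "F (\<lambda>x. (-1) * u x) \<le> F (\<lambda>x. \<bar>u x\<bar>)" using u by (intro positive_functional_mono[OF F]) auto
    moreover have "F (\<lambda>x. (-1) * u x) = - F u" using positive_functional_scale[OF F u, of "-1"] by simp
    moreover have "F (\<lambda>x. \<bar>u x\<bar>) \<le> K * (\<integral>x. \<bar>u x\<bar> \<partial>M)" by (rule K(2)) (auto simp: u)
    ultimately show ?thesis by linarith
  qed
  with K(1) show ?thesis by (rule that)
qed

lemma bounded_times_integrable:
  fixes w u :: "'a \<Rightarrow> real"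
  assumes "w \<in> borel_measurable M" "AE x in M. \<bar>w x\<bar> \<le> K" "integrable M u"
  shows "integrable M (\<lambda>x. w x * u x)"
proof (rule Bochner_Integration.integrable_bound)
  show "integrable M (\<lambda>x. K * u x)" using assms(3) by simp
  show "AE x in M. norm (w x * u x) \<le> norm (K * u x)"
    using assms(2) by eventually_elim (auto simp: abs_mult intro!: mult_right_mono)
  show "(\<lambda>x. w x * u x) \<in> borel_measurable M" using assms by measurable
qed

text \<open>
  A Riesz representation for the positive part of \<open>(L\<^sup>1)\<^sup>*\<close>. Boundedness of \<open>F\<close> turns
  \<open>E \<mapsto> F (indicator E)\<close> into a countably additive measure that is dominated by \<open>K\<close> times \<open>M\<close>. Its
  Radon-Nikodym density is therefore essentially bounded by \<open>K\<close>, and the representation extends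
  from indicators to all of \<open>L\<^sup>1\<close> because both sides are \<open>L\<^sup>1\<close>-continuous.
\<close>

lemma positive_functional_density:
  assumes "finite_measure M" and F: "positive_functional M F"
  obtains w K where "w \<in> borel_measurable M" "AE x in M. \<bar>w x\<bar> \<le> K"
    "\<And>u. integrable M u \<Longrightarrow> F u = (\<integral>x. w x * u x \<partial>M)"
proof -
  interpret finite_measure M by fact
  obtain K where K: "0 \<le> K" "\<And>u. integrable M u \<Longrightarrow> \<bar>F u\<bar> \<le> K * (\<integral>x. \<bar>u x\<bar> \<partial>M)"
    using positive_functional_bounded[OF F] by blast
  define \<nu> where "\<nu> E = ennreal (F (indicator E))" for E
  have intE: "integrable M (indicator E :: _ \<Rightarrow> real)" if "E \<in> sets M" for E
    using that by (simp add: integrable_indicator_iff emeasure_eq_measure)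
  have F0: "0 \<le> F (indicator E)" if "E \<in> sets M" for E
    using F intE[OF that] unfolding positive_functional_def by auto
  have FK: "F (indicator E) \<le> K * measure M E" if "E \<in> sets M" for E
    using K(2)[OF intE[OF that]] that by simp
  have "countably_additive (sets M) \<nu>"
  proof (rule countably_additiveI)
    fix E :: "nat \<Rightarrow> _" assume E: "range E \<subseteq> sets M" "disjoint_family E" "\<Union>(range E) \<in> sets M"
    have Ei: "E i \<in> sets M" for i using E(1) by auto
    have UnE: "(\<Union>i<n. E i) \<in> sets M" for n :: nat using Ei by auto
    \<comment> \<open>The tail of the series is \<open>F\<close> on the remaining set, which \<open>FK\<close> bounds by a vanishing measure.\<close>
    have split: "F (indicator (\<Union>(range E))) - (\<Sum>i<n. F (indicator (E i)))
        = F (indicator (\<Union>(range E) - (\<Union>i<n. E i)))" for n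
    proof -
      have "(\<Sum>i<n. F (indicator (E i))) = F (\<lambda>x. \<Sum>i<n. indicator (E i) x)"
        by (rule positive_functional_sum[OF F, symmetric]) (simp add: intE Ei)
      also have "(\<lambda>x. \<Sum>i<n. indicator (E i) x) = (indicator (\<Union>i<n. E i) :: _ \<Rightarrow> real)"
        using E(2) by (intro ext indicator_UN_disjoint[symmetric]) (auto simp: disjoint_family_on_def)
      finally have "F (indicator (\<Union>(range E))) - (\<Sum>i<n. F (indicator (E i)))
          = F (\<lambda>x. indicator (\<Union>(range E)) x - indicator (\<Union>i<n. E i) x)"
        by (simp add: positive_functional_diff[OF F intE[OF E(3)] intE[OF UnE]])
      also have "(\<lambda>x. indicator (\<Union>(range E)) x - indicator (\<Union>i<n. E i) x)
          = (indicator (\<Union>(range E) - (\<Union>i<n. E i)) :: _ \<Rightarrow> real)"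
        by (auto simp: indicator_def fun_eq_iff)
      finally show ?thesis .
    qed
    have meas: "measure M (\<Union>(range E) - (\<Union>i<n. E i)) = measure M (\<Union>(range E)) - (\<Sum>i<n. measure M (E i))" for n
    proof -
      have "measure M (\<Union>i<n. E i) = (\<Sum>i<n. measure M (E i))"
        using E(2) by (intro finite_measure_finite_Union) (auto simp: Ei disjoint_family_on_def)
      then show ?thesis by (subst finite_measure_Diff) (auto simp: Ei E(3))
    qed
    have "(\<lambda>n. measure M (\<Union>(range E)) - (\<Sum>i<n. measure M (E i))) \<longlonglongrightarrow> measure M (\<Union>(range E)) - measure M (\<Union>(range E))"
      using finite_measure_UNION[OF E(1,2)] by (intro tendsto_intros) (simp add: sums_def)
    then have lim: "(\<lambda>n. K * (measure M (\<Union>(range E) - (\<Union>i<n. E i)))) \<longlonglongrightarrow> 0"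
      by (simp add: meas tendsto_mult_right_zero)
    have "(\<lambda>n. F (indicator (\<Union>(range E))) - (\<Sum>i<n. F (indicator (E i)))) \<longlonglongrightarrow> 0"
      using E(3) UnE
      by (intro tendsto_sandwich[OF _ _ tendsto_const lim])
        (auto simp: split intro!: always_eventually F0 FK)
    then have "(\<lambda>n. F (indicator (\<Union>(range E))) - (F (indicator (\<Union>(range E))) - (\<Sum>i<n. F (indicator (E i))))) \<longlonglongrightarrow> F (indicator (\<Union>(range E))) - 0"
      by (intro tendsto_intros)
    then have "(\<lambda>i. F (indicator (E i))) sums F (indicator (\<Union>(range E)))"
      by (simp add: sums_def)
    then show "(\<Sum>i. \<nu> (E i)) = \<nu> (\<Union>(range E))"
      unfolding \<nu>_def using F0 Ei by (simp add: suminf_ennreal2 sums_iff)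
  qed
  moreover have "positive (sets M) \<nu>"
  proof -
    have "F (\<lambda>x. 0 * indicator {} x) = 0"
      using positive_functional_scale[OF F intE[of "{}"], of 0] by simp
    also have "(\<lambda>x. 0 * indicator {} x) = (indicator {} :: _ \<Rightarrow> real)" by auto
    finally show ?thesis by (simp only: \<nu>_def positive_def ennreal_0)
  qed
  ultimately have emN: "emeasure (measure_of (space M) (sets M) \<nu>) E = \<nu> E" if "E \<in> sets M" for E
    using emeasure_measure_of_sigma[OF sets.sigma_algebra_axioms] that by blast
  let ?N = "measure_of (space M) (sets M) \<nu>"
  have "absolutely_continuous M ?N"
    unfolding absolutely_continuous_def
  proof
    fix E assume "E \<in> null_sets M"
    then have E: "E \<in> sets M" "measure M E = 0" by (auto simp: measure_def)
    then have "\<nu> E = 0" using FK[OF E(1)] E(2) by (simp add: \<nu>_def ennreal_neg)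
    then show "E \<in> null_sets ?N" using E(1) emN by auto
  qed
  then obtain h where h[measurable]: "h \<in> borel_measurable M" and hN: "density M h = ?N"
    using Radon_Nikodym[of ?N] by auto
  have h_int: "(\<integral>\<^sup>+x. h x * indicator E x \<partial>M) = ennreal (F (indicator E))" if "E \<in> sets M" for E
    using emeasure_density[OF h that] emN[OF that] by (simp add: hN \<nu>_def)
  have hK: "AE x in M. h x \<le> ennreal K"
  proof -
    define E where "E = {x \<in> space M. ennreal K < h x}"
    have E[measurable]: "E \<in> sets M" unfolding E_def by measurable
    have K_int: "(\<integral>\<^sup>+x. ennreal K * indicator E x \<partial>M) = ennreal (K * measure M E)"
      by (simp add: nn_integral_cmult_indicator emeasure_eq_measure ennreal_mult K(1))
    have "AE x in M. h x * indicator E x \<le> ennreal K * indicator E x"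
    proof (rule ccontr)
      assume *: "\<not> ?thesis"
      have "(\<integral>\<^sup>+x. ennreal K * indicator E x \<partial>M) < (\<integral>\<^sup>+x. h x * indicator E x \<partial>M)"
      proof (rule nn_integral_less[OF _ _ _ _ *])
        show "AE x in M. ennreal K * indicator E x \<le> h x * indicator E x"
          by (auto simp: E_def indicator_def)
      qed (auto simp: K_int)
      then show False
        using FK[OF E] by (simp add: K_int h_int[OF E] ennreal_less_iff K(1) not_le)
    qed
    then show ?thesis
    proof (rule AE_mp, intro AE_I2 impI)
      fix x assume "x \<in> space M" "h x * indicator E x \<le> ennreal K * indicator E x"
      then show "h x \<le> ennreal K" by (cases "x \<in> E") (auto simp: E_def not_less)
    qed
  qed
  define w where "w x = enn2real (h x)" for x
  have w[measurable]: "w \<in> borel_measurable M" unfolding w_def by measurable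
  have wh: "AE x in M. ennreal (w x) = h x"
    using hK by eventually_elim (auto simp: w_def intro!: ennreal_enn2real elim: le_less_trans)
  have wK: "AE x in M. \<bar>w x\<bar> \<le> K"
    using hK by eventually_elim (auto simp: w_def K(1) intro: enn2real_leI)
  have repr: "F u = (\<integral>x. w x * u x \<partial>M)" if "integrable M u" for u
    using that
  proof (induction rule: integrable_induct)
    case (base E c)
    have "ennreal (F (indicator E)) = (\<integral>\<^sup>+x. ennreal (w x * indicator E x) \<partial>M)"
      unfolding h_int[OF base(1), symmetric]
      by (rule nn_integral_cong_AE, use wh in eventually_elim) (auto simp: indicator_def)
    also have "\<dots> = ennreal (\<integral>x. w x * indicator E x \<partial>M)"
      by (intro nn_integral_eq_integral bounded_times_integrable[OF w wK] intE base(1))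
        (auto simp: w_def)
    finally have "F (indicator E) = (\<integral>x. w x * indicator E x \<partial>M)"
      by (subst (asm) ennreal_inj) (auto simp: F0 base w_def intro!: integral_nonneg_AE)
    then show ?case
      using positive_functional_scale[OF F intE[OF base(1)], of c]
      by (simp add: mult.commute[of _ c] mult.left_commute[of _ c])
  next
    case (add u v)
    have "F (\<lambda>x. u x + v x) = F u + F v"
      using positive_functional_lin[OF F add(1,2), of 1 1] by simp
    then show ?case
      by (simp add: add distrib_left bounded_times_integrable[OF w wK])
  next
    case (lim u s)
    have [measurable]: "u \<in> borel_measurable M" "s i \<in> borel_measurable M" for i
      using lim by auto
    have "(\<lambda>i. \<integral>x. \<bar>s i x - u x\<bar> \<partial>M) \<longlonglongrightarrow> (\<integral>x. 0 \<partial>M)"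
    proof (rule integral_dominated_convergence[where w = "\<lambda>x. 3 * \<bar>u x\<bar>"])
      show "AE x in M. (\<lambda>i. \<bar>s i x - u x\<bar>) \<longlonglongrightarrow> 0"
        using lim(2) by (intro AE_I2 tendsto_rabs_zero) (simp add: LIM_zero)
      show "AE x in M. norm \<bar>s i x - u x\<bar> \<le> 3 * \<bar>u x\<bar>" for i
        using lim(3)[of _ i] by (intro AE_I2) (fastforce simp: abs_if split: if_splits)
    qed (use lim in auto)
    then have L1: "(\<lambda>i. K * (\<integral>x. \<bar>s i x - u x\<bar> \<partial>M)) \<longlonglongrightarrow> 0"
      by (simp add: tendsto_mult_right_zero)
    have "(\<lambda>i. F (s i) - F u) \<longlonglongrightarrow> 0"
    proof (rule Lim_null_comparison[OF _ L1], rule always_eventually, rule allI)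
      fix i show "norm (F (s i) - F u) \<le> K * (\<integral>x. \<bar>s i x - u x\<bar> \<partial>M)"
        using K(2)[of "\<lambda>x. s i x - u x"] lim by (simp add: positive_functional_diff[OF F])
    qed
    moreover have "(\<lambda>i. (\<integral>x. w x * s i x \<partial>M) - (\<integral>x. w x * u x \<partial>M)) \<longlonglongrightarrow> 0"
    proof (rule Lim_null_comparison[OF _ L1], rule always_eventually, rule allI)
      fix i
      have wsu: "integrable M (\<lambda>x. w x * (s i x - u x))"
        using lim by (intro bounded_times_integrable[OF w wK]) auto
      have "(\<integral>x. w x * s i x \<partial>M) - (\<integral>x. w x * u x \<partial>M) = (\<integral>x. w x * (s i x - u x) \<partial>M)"
        using lim by (simp add: right_diff_distrib bounded_times_integrable[OF w wK])
      also have "\<bar>\<dots>\<bar> \<le> (\<integral>x. \<bar>w x * (s i x - u x)\<bar> \<partial>M)" by (rule integral_abs_bound)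
      also have "\<dots> \<le> (\<integral>x. K * \<bar>s i x - u x\<bar> \<partial>M)"
      proof (intro integral_mono_AE)
        show "integrable M (\<lambda>x. \<bar>w x * (s i x - u x)\<bar>)" using wsu by simp
        show "AE x in M. \<bar>w x * (s i x - u x)\<bar> \<le> K * \<bar>s i x - u x\<bar>"
          using wK by eventually_elim (simp add: abs_mult mult_right_mono)
      qed (use lim in simp)
      finally show "norm ((\<integral>x. w x * s i x \<partial>M) - (\<integral>x. w x * u x \<partial>M)) \<le> K * (\<integral>x. \<bar>s i x - u x\<bar> \<partial>M)"
        by simp
    qed
    ultimately show ?case
      by (intro LIMSEQ_unique[of "\<lambda>i. F (s i)"]) (simp_all add: LIM_zero_iff lim(5))
  qed
  show ?thesis by (rule that[OF w wK repr])
qed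

section \<open>Essentially bounded functions on a domain\<close>

lemma Linf_norm_le:
  assumes "p \<in> borel_measurable (lebesgue_on \<Omega>)" "AE x in lebesgue_on \<Omega>. \<bar>p x\<bar> \<le> c"
  shows "Linf_norm \<Omega> p \<le> ennreal c"
  unfolding Linf_norm_def using assms
  by (intro esssup_I) (auto intro: ennreal_leI elim: eventually_mono)

lemma Linf_I:
  assumes "p \<in> borel_measurable (lebesgue_on \<Omega>)" "AE x in lebesgue_on \<Omega>. \<bar>p x\<bar> \<le> c"
  shows "p \<in> Linf \<Omega>"
  using Linf_norm_le[OF assms] assms(1) unfolding Linf_def
  by (auto intro: le_less_trans)

lemma Linf_AE_bound:
  assumes "p \<in> Linf \<Omega>" "Linf_norm \<Omega> p \<le> ennreal c" "0 \<le> c"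
  shows "AE x in lebesgue_on \<Omega>. \<bar>p x\<bar> \<le> c"
  using esssup_AE[of "\<lambda>x. ennreal \<bar>p x\<bar>" "lebesgue_on \<Omega>"]
proof eventually_elim
  case (elim x)
  then have "ennreal \<bar>p x\<bar> \<le> ennreal c"
    using assms(2) unfolding Linf_norm_def by (rule order_trans)
  then show ?case using assms(3) by (simp add: ennreal_le_iff)
qed

lemma Linf_E:
  assumes "p \<in> Linf \<Omega>"
  obtains c where "0 \<le> c" "p \<in> borel_measurable (lebesgue_on \<Omega>)"
    "AE x in lebesgue_on \<Omega>. \<bar>p x\<bar> \<le> c"
proof
  show "AE x in lebesgue_on \<Omega>. \<bar>p x\<bar> \<le> enn2real (Linf_norm \<Omega> p)"
    using assms by (intro Linf_AE_bound) (auto simp: Linf_def)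
qed (use assms in \<open>auto simp: Linf_def\<close>)

lemma Linf_lin:
  assumes "p \<in> Linf \<Omega>" "q \<in> Linf \<Omega>"
  shows "(\<lambda>x. a * p x + b * q x) \<in> Linf \<Omega>"
proof -
  obtain c where c: "p \<in> borel_measurable (lebesgue_on \<Omega>)" "AE x in lebesgue_on \<Omega>. \<bar>p x\<bar> \<le> c"
    using assms(1) by (elim Linf_E)
  obtain d where d: "q \<in> borel_measurable (lebesgue_on \<Omega>)" "AE x in lebesgue_on \<Omega>. \<bar>q x\<bar> \<le> d"
    using assms(2) by (elim Linf_E)
  show ?thesis
  proof (rule Linf_I[where c = "\<bar>a\<bar> * c + \<bar>b\<bar> * d"])
    show "AE x in lebesgue_on \<Omega>. \<bar>a * p x + b * q x\<bar> \<le> \<bar>a\<bar> * c + \<bar>b\<bar> * d"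
      using c(2) d(2)
    proof eventually_elim
      case (elim x)
      have "\<bar>a * p x + b * q x\<bar> \<le> \<bar>a\<bar> * \<bar>p x\<bar> + \<bar>b\<bar> * \<bar>q x\<bar>"
        by (metis abs_mult abs_triangle_ineq)
      also have "\<dots> \<le> \<bar>a\<bar> * c + \<bar>b\<bar> * d"
        using elim by (intro add_mono mult_left_mono) auto
      finally show ?case .
    qed
  qed (use c(1) d(1) in measurable)
qed

lemma Linf_diff: "p \<in> Linf \<Omega> \<Longrightarrow> q \<in> Linf \<Omega> \<Longrightarrow> (\<lambda>x. p x - q x) \<in> Linf \<Omega>"
  using Linf_lin[of p \<Omega> q 1 "-1"] by simp

lemma Linf_uminus: "p \<in> Linf \<Omega> \<Longrightarrow> (\<lambda>x. - p x) \<in> Linf \<Omega>"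
  using Linf_lin[of p \<Omega> p "-1" 0] by simp

lemma Linf_const: "(\<lambda>_. c) \<in> Linf \<Omega>"
  by (rule Linf_I[where c = "\<bar>c\<bar>"]) auto

lemma Linf_times_L1_integrable:
  assumes "p \<in> Linf \<Omega>" "u \<in> L1 \<Omega>"
  shows "integrable (lebesgue_on \<Omega>) (\<lambda>x. p x * u x)"
  using assms by (elim Linf_E) (auto simp: L1_def intro: bounded_times_integrable)

lemma L1_lin: "u \<in> L1 \<Omega> \<Longrightarrow> v \<in> L1 \<Omega> \<Longrightarrow> (\<lambda>x. a * u x + b * v x) \<in> L1 \<Omega>"
  by (simp add: L1_def)

lemma finite_measure_lebesgue_on_bounded:
  assumes "domain_set \<Omega>" "bounded \<Omega>"
  shows "finite_measure (lebesgue_on \<Omega>)"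
proof
  have "\<Omega> \<in> lmeasurable" using assms by (simp add: domain_set_def lmeasurable_open)
  then show "emeasure (lebesgue_on \<Omega>) (space (lebesgue_on \<Omega>)) \<noteq> \<infinity>"
    using fmeasurableD2[of \<Omega> lebesgue] by (simp add: emeasure_restrict_space fmeasurableD)
qed

section \<open>Non-negative functionals on essentially bounded functions\<close>

definition mass :: "'m functional \<times> 'm functional \<Rightarrow> real" where
  "mass \<mu> = fst \<mu> (\<lambda>_. 1) + snd \<mu> (\<lambda>_. 1)"

lemma Linf_dual_lin:
  assumes "\<mu> \<in> Linf_dual \<Omega>" "p \<in> Linf \<Omega>" "q \<in> Linf \<Omega>"
  shows "\<mu> (\<lambda>x. a * p x + b * q x) = a * \<mu> p + b * \<mu> q"
  using assms unfolding Linf_dual_def by blast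

lemma Linf_dual_diff:
  assumes "\<mu> \<in> Linf_dual \<Omega>" "p \<in> Linf \<Omega>" "q \<in> Linf \<Omega>"
  shows "\<mu> (\<lambda>x. p x - q x) = \<mu> p - \<mu> q"
  using Linf_dual_lin[OF assms, of 1 "-1"] by simp

lemma Linf_dual_uminus:
  assumes "\<mu> \<in> Linf_dual \<Omega>" "p \<in> Linf \<Omega>"
  shows "\<mu> (\<lambda>x. - p x) = - \<mu> p"
  using Linf_dual_lin[OF assms assms(2), of "-1" 0] by simp

lemma Linf_dual_const:
  assumes "\<mu> \<in> Linf_dual \<Omega>"
  shows "\<mu> (\<lambda>_. c) = c * \<mu> (\<lambda>_. 1)"
  using Linf_dual_lin[OF assms Linf_const Linf_const, of c 1 0 1] by simp

lemma dual_nonneg_mono: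
  assumes "\<mu> \<in> Linf_dual \<Omega>" "dual_nonneg \<Omega> \<mu>" "p \<in> Linf \<Omega>" "q \<in> Linf \<Omega>" "ae_le \<Omega> p q"
  shows "\<mu> p \<le> \<mu> q"
proof -
  have "ae_le \<Omega> (\<lambda>_. 0) (\<lambda>x. q x - p x)" using assms(5) by (simp add: ae_le_def)
  then have "0 \<le> \<mu> (\<lambda>x. q x - p x)"
    using assms(2) Linf_diff[OF assms(4,3)] unfolding dual_nonneg_def by blast
  then show ?thesis using Linf_dual_diff[OF assms(1,4,3)] by simp
qed

text \<open>
  A functional on \<open>L\<^sup>\<infinity>\<close> that is non-negative on almost everywhere non-negative functions cannot
  see null sets: both inequalities hold between functions that agree almost everywhere.
\<close>

lemma dual_nonneg_cong:
  assumes "\<mu> \<in> Linf_dual \<Omega>" "dual_nonneg \<Omega> \<mu>" "p \<in> Linf \<Omega>" "q \<in> Linf \<Omega>" "ae_eq \<Omega> p q"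
  shows "\<mu> p = \<mu> q"
  using assms(5) by (intro antisym dual_nonneg_mono[OF assms(1,2)] assms(3,4))
    (auto simp: ae_le_def ae_eq_def elim: eventually_mono)

lemma positive_functional_comp:
  fixes \<Omega> :: "(real ^ 'm) set"
  assumes "\<mu> \<in> Linf_dual \<Omega>" "dual_nonneg \<Omega> \<mu>" "positive_op \<Omega> P"
  shows "positive_functional (lebesgue_on \<Omega>) (\<lambda>u. \<mu> (P u))"
  unfolding positive_functional_def
proof (intro conjI allI impI)
  fix u v :: "'m fn" and a b assume "integrable (lebesgue_on \<Omega>) u" "integrable (lebesgue_on \<Omega>) v"
  then have uv: "u \<in> L1 \<Omega>" "v \<in> L1 \<Omega>" by (auto simp: L1_def)
  then have P: "P u \<in> Linf \<Omega>" "P v \<in> Linf \<Omega>" "P (\<lambda>x. a * u x + b * v x) \<in> Linf \<Omega>"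
    "ae_eq \<Omega> (P (\<lambda>x. a * u x + b * v x)) (\<lambda>x. a * P u x + b * P v x)"
    using assms(3) by (auto simp: positive_op_def linear_op_def L1_lin)
  have "\<mu> (P (\<lambda>x. a * u x + b * v x)) = \<mu> (\<lambda>x. a * P u x + b * P v x)"
    using assms P by (intro dual_nonneg_cong[OF assms(1,2)]) (auto simp: Linf_lin)
  then show "\<mu> (P (\<lambda>x. a * u x + b * v x)) = a * \<mu> (P u) + b * \<mu> (P v)"
    using Linf_dual_lin[OF assms(1)] P by simp
next
  fix u :: "'m fn" assume "integrable (lebesgue_on \<Omega>) u" "AE x in lebesgue_on \<Omega>. 0 \<le> u x"
  then show "0 \<le> \<mu> (P u)"
    using assms by (auto simp: positive_op_def linear_op_def dual_nonneg_def L1_def ae_le_def)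
qed

section \<open>Adjoints of operator bounds\<close>

text \<open>
  A non-negative \<open>\<mu>\<close> composed with a regular operator is the difference of two positive functionals
  on \<open>L\<^sup>1\<close>. So \<open>\<mu>\<close> may be purely finitely additive and the composition is still given by an
  \<open>L\<^sup>\<infinity>\<close> function.
\<close>

lemma regular_functional_density:
  assumes "finite_measure (lebesgue_on \<Omega>)"
    and \<mu>: "\<mu> \<in> Linf_dual \<Omega>" "dual_nonneg \<Omega> \<mu>" and T: "regular_op \<Omega> T"
  obtains w where "w \<in> Linf \<Omega>" "\<And>u. u \<in> L1 \<Omega> \<Longrightarrow> \<mu> (T u) = pairing \<Omega> w u"
proof -
  have pos: "\<exists>w\<in>Linf \<Omega>. \<forall>u\<in>L1 \<Omega>. \<mu> (P u) = pairing \<Omega> w u" if P: "positive_op \<Omega> P" for P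
  proof -
    obtain w K where "w \<in> borel_measurable (lebesgue_on \<Omega>)" "AE x in lebesgue_on \<Omega>. \<bar>w x\<bar> \<le> K"
      and "\<And>u. integrable (lebesgue_on \<Omega>) u \<Longrightarrow> \<mu> (P u) = (\<integral>x. w x * u x \<partial>lebesgue_on \<Omega>)"
      using positive_functional_density[OF assms(1) positive_functional_comp[OF \<mu> P]] by blast
    then show ?thesis
      by (intro bexI[of _ w]) (auto simp: L1_def pairing_def intro: Linf_I)
  qed
  obtain P Q where PQ: "positive_op \<Omega> P" "positive_op \<Omega> Q" "\<forall>u\<in>L1 \<Omega>. ae_eq \<Omega> (T u) (P u - Q u)"
    using T unfolding regular_op_def by blast
  obtain w where w: "w \<in> Linf \<Omega>" "\<And>u. u \<in> L1 \<Omega> \<Longrightarrow> \<mu> (P u) = pairing \<Omega> w u"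
    using pos[OF PQ(1)] by blast
  obtain z where z: "z \<in> Linf \<Omega>" "\<And>u. u \<in> L1 \<Omega> \<Longrightarrow> \<mu> (Q u) = pairing \<Omega> z u"
    using pos[OF PQ(2)] by blast
  show ?thesis
  proof (rule that[OF Linf_diff[OF w(1) z(1)]])
    fix u assume u: "u \<in> L1 \<Omega>"
    have L: "T u \<in> Linf \<Omega>" "P u \<in> Linf \<Omega>" "Q u \<in> Linf \<Omega>"
      using T PQ u by (auto simp: regular_op_def positive_op_def linear_op_def)
    have "\<mu> (T u) = \<mu> (\<lambda>x. P u x - Q u x)"
      using PQ(3) u L by (intro dual_nonneg_cong[OF \<mu>]) (auto simp: Linf_diff fun_diff_def)
    also have "\<dots> = pairing \<Omega> w u - pairing \<Omega> z u"
      using Linf_dual_diff[OF \<mu>(1) L(2,3)] w z u by simp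
    also have "\<dots> = pairing \<Omega> (\<lambda>x. w x - z x) u"
      using Linf_times_L1_integrable[OF w(1) u] Linf_times_L1_integrable[OF z(1) u]
      by (simp add: pairing_def left_diff_distrib)
    finally show "\<mu> (T u) = pairing \<Omega> (\<lambda>x. w x - z x) u" .
  qed
qed

lemma pairing_diff:
  assumes "p \<in> Linf \<Omega>" "q \<in> Linf \<Omega>" "u \<in> L1 \<Omega>"
  shows "pairing \<Omega> (p - q) u = pairing \<Omega> p u - pairing \<Omega> q u"
  using Linf_times_L1_integrable[OF assms(1,3)] Linf_times_L1_integrable[OF assms(2,3)]
  by (simp add: pairing_def left_diff_distrib)

lemma pairing_uminus: "pairing \<Omega> (- p) u = - pairing \<Omega> p u"
  by (simp add: pairing_def)

text \<open>
  The adjoint is defined by a choice, so it has its defining property only once a representing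
  function is exhibited.
\<close>

lemma adjoint_op_bound_op:
  assumes "finite_measure (lebesgue_on \<Omega>)"
    and \<mu>: "\<mu> \<in> Linf_dual \<Omega> \<times> Linf_dual \<Omega>" "dual_pair_nonneg \<Omega> \<mu>"
    and T: "regular_op \<Omega> S" "regular_op \<Omega> T"
  shows "adjoint_op \<Omega> (bound_op S T) \<mu> \<in> Linf \<Omega>"
    and "u \<in> L1 \<Omega> \<Longrightarrow> pairing \<Omega> (adjoint_op \<Omega> (bound_op S T) \<mu>) u
      = dual_pairing \<mu> (bound_op S T u)"
proof -
  have mu: "fst \<mu> \<in> Linf_dual \<Omega>" "dual_nonneg \<Omega> (fst \<mu>)" "snd \<mu> \<in> Linf_dual \<Omega>" "dual_nonneg \<Omega> (snd \<mu>)"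
    using \<mu> by (auto simp: dual_pair_nonneg_def)
  obtain w where w: "w \<in> Linf \<Omega>" "\<And>u. u \<in> L1 \<Omega> \<Longrightarrow> fst \<mu> (S u) = pairing \<Omega> w u"
    using regular_functional_density[OF assms(1) mu(1,2) T(1)] by blast
  obtain z where z: "z \<in> Linf \<Omega>" "\<And>u. u \<in> L1 \<Omega> \<Longrightarrow> snd \<mu> (T u) = pairing \<Omega> z u"
    using regular_functional_density[OF assms(1) mu(3,4) T(2)] by blast
  have "pairing \<Omega> (w - z) u = dual_pairing \<mu> (bound_op S T u)" if u: "u \<in> L1 \<Omega>" for u
  proof -
    have "T u \<in> Linf \<Omega>" using T(2) u by (auto simp: regular_op_def linear_op_def)
    then have "snd \<mu> (- T u) = - snd \<mu> (T u)"
      using Linf_dual_uminus[OF mu(3)] by (simp add: fun_Compl_def)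
    then show ?thesis
      using w z u by (simp add: dual_pairing_def bound_op_def pairing_diff)
  qed
  moreover have "w - z \<in> Linf \<Omega>" using Linf_diff[OF w(1) z(1)] by (simp add: fun_diff_def)
  ultimately have "\<exists>w. w \<in> Linf \<Omega> \<and> (\<forall>u\<in>L1 \<Omega>. pairing \<Omega> w u = dual_pairing \<mu> (bound_op S T u))"
    by blast
  from someI_ex[OF this]
  have "adjoint_op \<Omega> (bound_op S T) \<mu> \<in> Linf \<Omega> \<and>
    (\<forall>u\<in>L1 \<Omega>. pairing \<Omega> (adjoint_op \<Omega> (bound_op S T) \<mu>) u = dual_pairing \<mu> (bound_op S T u))"
    unfolding adjoint_op_def .
  then show "adjoint_op \<Omega> (bound_op S T) \<mu> \<in> Linf \<Omega>"
    and "u \<in> L1 \<Omega> \<Longrightarrow> pairing \<Omega> (adjoint_op \<Omega> (bound_op S T) \<mu>) u = dual_pairing \<mu> (bound_op S T u)"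
    by simp_all
qed

lemma linear_op_lin:
  assumes S: "linear_op \<Omega> S" and T: "linear_op \<Omega> T"
  shows "linear_op \<Omega> (\<lambda>u x. a * S u x + b * T u x)"
  unfolding linear_op_def
proof (intro conjI ballI allI impI)
  fix u assume "u \<in> L1 \<Omega>"
  then have "S u \<in> Linf \<Omega>" "T u \<in> Linf \<Omega>" using S T by (auto simp: linear_op_def)
  then show "(\<lambda>x. a * S u x + b * T u x) \<in> Linf \<Omega>" by (rule Linf_lin)
next
  fix u v assume uv: "u \<in> L1 \<Omega>" "v \<in> L1 \<Omega>" "ae_eq \<Omega> u v"
  have "ae_eq \<Omega> (S u) (S v)" "ae_eq \<Omega> (T u) (T v)" using S T uv by (auto simp: linear_op_def)
  then show "ae_eq \<Omega> (\<lambda>x. a * S u x + b * T u x) (\<lambda>x. a * S v x + b * T v x)"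
    unfolding ae_eq_def by eventually_elim simp
next
  fix u v c d assume uv: "u \<in> L1 \<Omega>" "v \<in> L1 \<Omega>"
  have "ae_eq \<Omega> (S (\<lambda>x. c * u x + d * v x)) (\<lambda>x. c * S u x + d * S v x)"
    "ae_eq \<Omega> (T (\<lambda>x. c * u x + d * v x)) (\<lambda>x. c * T u x + d * T v x)"
    using S T uv by (auto simp: linear_op_def)
  then show "ae_eq \<Omega> (\<lambda>x. a * S (\<lambda>x. c * u x + d * v x) x + b * T (\<lambda>x. c * u x + d * v x) x)
      (\<lambda>x. c * (a * S u x + b * T u x) + d * (a * S v x + b * T v x))"
    unfolding ae_eq_def by eventually_elim (simp add: algebra_simps)
qed

lemma linear_op_diff:
  assumes "linear_op \<Omega> S" "linear_op \<Omega> T"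
  shows "linear_op \<Omega> (\<lambda>u. S u - T u)"
  using linear_op_lin[OF assms, of 1 "-1"] by (simp add: fun_diff_def)

text \<open>
  The exact operator is only assumed linear. A regular lower bound \<open>T = P - Q\<close> makes it regular
  too, since \<open>A + Q\<close> dominates \<open>T + Q = P\<close> and is thus positive.
\<close>

lemma regular_op_above:
  assumes A: "linear_op \<Omega> A" and T: "regular_op \<Omega> T" and le: "op_le \<Omega> T A"
  shows "regular_op \<Omega> A"
proof -
  obtain P Q where PQ: "positive_op \<Omega> P" "positive_op \<Omega> Q" "\<forall>u\<in>L1 \<Omega>. ae_eq \<Omega> (T u) (P u - Q u)"
    using T unfolding regular_op_def by blast
  let ?R = "\<lambda>u x. A u x + Q u x"
  have "linear_op \<Omega> ?R"
    using linear_op_lin[OF A, of Q 1 1] PQ(2) by (simp add: positive_op_def)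
  moreover have "ae_le \<Omega> (\<lambda>_. 0) (?R u)" if u: "u \<in> L1 \<Omega>" "ae_le \<Omega> (\<lambda>_. 0) u" for u
  proof -
    have "ae_le \<Omega> (\<lambda>_. 0) (A u - T u)" "ae_le \<Omega> (\<lambda>_. 0) (P u)" "ae_eq \<Omega> (T u) (P u - Q u)"
      using le PQ u by (auto simp: op_le_def positive_op_def)
    then show ?thesis unfolding ae_eq_def ae_le_def by eventually_elim simp
  qed
  ultimately have "positive_op \<Omega> ?R" by (simp add: positive_op_def)
  moreover have "ae_eq \<Omega> (A u) (?R u - Q u)" for u by (simp add: ae_eq_def)
  ultimately show ?thesis using A PQ(2) unfolding regular_op_def by blast
qed

section \<open>Comparison of operator bounds with the exact operator\<close>

lemma L1_norm_eq: "u \<in> L1 \<Omega> \<Longrightarrow> L1_norm \<Omega> u = ennreal (\<integral>x. \<bar>u x\<bar> \<partial>lebesgue_on \<Omega>)"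
  unfolding L1_norm_def L1_def by (intro nn_integral_eq_integral) auto

text \<open>
  Passage from the operator norm, which only tests the unit ball, to all of \<open>L\<^sup>1\<close>. Functions of
  norm 0 cannot be normalised; for them \<open>T u = T 0 = 0\<close> almost everywhere.
\<close>

lemma linear_op_AE_bound:
  assumes T: "linear_op \<Omega> T" and "0 \<le> K"
    and unit: "\<And>u. u \<in> L1 \<Omega> \<Longrightarrow> L1_norm \<Omega> u \<le> 1 \<Longrightarrow> Linf_norm \<Omega> (T u) \<le> ennreal K"
    and u: "u \<in> L1 \<Omega>"
  shows "AE x in lebesgue_on \<Omega>. \<bar>T u x\<bar> \<le> K * (\<integral>x. \<bar>u x\<bar> \<partial>lebesgue_on \<Omega>)"
proof -
  define t where "t = (\<integral>x. \<bar>u x\<bar> \<partial>lebesgue_on \<Omega>)"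
  have int: "integrable (lebesgue_on \<Omega>) (\<lambda>x. \<bar>u x\<bar>)" using u by (simp add: L1_def)
  \<comment> \<open>The summand \<open>0 * u x\<close> gives the multiple of \<open>u\<close> the two-term form in which linearity is stated.\<close>
  have hom: "ae_eq \<Omega> (T (\<lambda>x. c * u x + 0 * u x)) (\<lambda>x. c * T u x + 0 * T u x)" for c
    using T u unfolding linear_op_def by blast
  have L1c: "(\<lambda>x. c * u x + 0 * u x) \<in> L1 \<Omega>" for c by (rule L1_lin[OF u u])
  show ?thesis
  proof (cases "t = 0")
    case True
    then have "AE x in lebesgue_on \<Omega>. \<bar>u x\<bar> = 0"
      using int by (simp add: t_def integral_nonneg_eq_0_iff_AE)
    then have "ae_eq \<Omega> u (\<lambda>x. 0 * u x + 0 * u x)" by (simp add: ae_eq_def)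
    then have "ae_eq \<Omega> (T u) (T (\<lambda>x. 0 * u x + 0 * u x))"
      using T u L1c unfolding linear_op_def by blast
    with hom[of 0] show ?thesis
      unfolding ae_eq_def t_def[symmetric] True by eventually_elim simp
  next
    case False
    then have t: "0 < t" by (simp add: t_def less_le)
    let ?v = "\<lambda>x. inverse t * u x + 0 * u x"
    have "(\<integral>x. \<bar>?v x\<bar> \<partial>lebesgue_on \<Omega>) = inverse t * t"
      using t by (simp add: abs_mult t_def)
    then have "L1_norm \<Omega> ?v \<le> 1" using t L1_norm_eq[OF L1c] by simp
    then have "AE x in lebesgue_on \<Omega>. \<bar>T ?v x\<bar> \<le> K"
      using T L1c by (intro Linf_AE_bound unit assms(2)) (auto simp: linear_op_def)
    with hom[of "inverse t"] show ?thesis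
      unfolding ae_eq_def t_def[symmetric]
    proof eventually_elim
      case (elim x)
      then have "\<bar>T u x\<bar> / t \<le> K" using t by (simp add: abs_mult divide_inverse mult.commute)
      then show ?case using t by (simp add: pos_divide_le_eq)
    qed
  qed
qed

lemma dual_nonneg_le_const:
  assumes "\<mu> \<in> Linf_dual \<Omega>" "dual_nonneg \<Omega> \<mu>" "p \<in> Linf \<Omega>" "ae_le \<Omega> p (\<lambda>_. c)"
  shows "\<mu> p \<le> c * \<mu> (\<lambda>_. 1)"
  using dual_nonneg_mono[OF assms(1-3) Linf_const assms(4)] Linf_dual_const[OF assms(1), of c] by simp

lemma dual_nonneg_ge_const:
  assumes "\<mu> \<in> Linf_dual \<Omega>" "dual_nonneg \<Omega> \<mu>" "p \<in> Linf \<Omega>" "ae_le \<Omega> (\<lambda>_. c) p"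
  shows "c * \<mu> (\<lambda>_. 1) \<le> \<mu> p"
  using dual_nonneg_mono[OF assms(1,2) Linf_const assms(3,4)] Linf_dual_const[OF assms(1), of c] by simp

text \<open>
  For non-negative functionals the total mass plays the role of the norm: comparing with constants
  is all that is needed of duality.
\<close>

lemma dual_pairing_const_bounds:
  assumes mu: "\<mu> \<in> Linf_dual \<Omega> \<times> Linf_dual \<Omega>" "dual_pair_nonneg \<Omega> \<mu>"
    and psi: "fst \<psi> \<in> Linf \<Omega>" "snd \<psi> \<in> Linf \<Omega>"
  shows "pair_le \<Omega> \<psi> (const_pair c) \<Longrightarrow> dual_pairing \<mu> \<psi> \<le> c * mass \<mu>"
    and "pair_le \<Omega> (const_pair c) \<psi> \<Longrightarrow> c * mass \<mu> \<le> dual_pairing \<mu> \<psi>"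
proof -
  have m: "fst \<mu> \<in> Linf_dual \<Omega>" "dual_nonneg \<Omega> (fst \<mu>)" "snd \<mu> \<in> Linf_dual \<Omega>" "dual_nonneg \<Omega> (snd \<mu>)"
    using mu by (auto simp: dual_pair_nonneg_def)
  show "dual_pairing \<mu> \<psi> \<le> c * mass \<mu>" if "pair_le \<Omega> \<psi> (const_pair c)"
    using dual_nonneg_le_const[OF m(1,2) psi(1)] dual_nonneg_le_const[OF m(3,4) psi(2)] that
    by (simp add: dual_pairing_def mass_def pair_le_def const_pair_def distrib_left add_mono)
  show "c * mass \<mu> \<le> dual_pairing \<mu> \<psi>" if "pair_le \<Omega> (const_pair c) \<psi>"
    using dual_nonneg_ge_const[OF m(1,2) psi(1)] dual_nonneg_ge_const[OF m(3,4) psi(2)] that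
    by (simp add: dual_pairing_def mass_def pair_le_def const_pair_def distrib_left add_mono)
qed

lemma mass_nonneg:
  assumes "dual_pair_nonneg \<Omega> \<mu>"
  shows "0 \<le> mass \<mu>"
proof -
  have "ae_le \<Omega> (\<lambda>_. 0) (\<lambda>_. 1)" by (simp add: ae_le_def)
  then show ?thesis
    using assms Linf_const[of 1 \<Omega>]
    unfolding mass_def dual_pair_nonneg_def dual_nonneg_def by (intro add_nonneg_nonneg) blast+
qed

lemma dual_pairing_diff:
  assumes "\<mu> \<in> Linf_dual \<Omega> \<times> Linf_dual \<Omega>"
    and "fst \<psi> \<in> Linf \<Omega>" "snd \<psi> \<in> Linf \<Omega>" "fst \<xi> \<in> Linf \<Omega>" "snd \<xi> \<in> Linf \<Omega>"
  shows "dual_pairing \<mu> (\<psi> - \<xi>) = dual_pairing \<mu> \<psi> - dual_pairing \<mu> \<xi>"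
  using assms Linf_dual_diff[of "fst \<mu>" \<Omega> "fst \<psi>" "fst \<xi>"] Linf_dual_diff[of "snd \<mu>" \<Omega> "snd \<psi>" "snd \<xi>"]
  by (auto simp: dual_pairing_def fun_diff_def)

lemma dual_pairing_uminus:
  assumes "\<mu> \<in> Linf_dual \<Omega> \<times> Linf_dual \<Omega>" "fst \<psi> \<in> Linf \<Omega>" "snd \<psi> \<in> Linf \<Omega>"
  shows "dual_pairing \<mu> (- \<psi>) = - dual_pairing \<mu> \<psi>"
  using assms Linf_dual_uminus[of "fst \<mu>" \<Omega> "fst \<psi>"] Linf_dual_uminus[of "snd \<mu>" \<Omega> "snd \<psi>"]
  by (auto simp: dual_pairing_def fun_Compl_def)

lemma bound_op_Linf:
  assumes "linear_op \<Omega> S" "linear_op \<Omega> T" "u \<in> L1 \<Omega>"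
  shows "fst (bound_op S T u) \<in> Linf \<Omega>" "snd (bound_op S T u) \<in> Linf \<Omega>"
  using assms Linf_uminus[of "T u" \<Omega>] by (auto simp: bound_op_def linear_op_def fun_Compl_def)

text \<open>
  Since \<open>S \<le> A \<le> T\<close>, both components of \<open>(A u, - A u) - (S u, - T u)\<close> are non-negative for \<open>u \<ge> 0\<close>.
\<close>

lemma bound_op_mono:
  assumes mu: "\<mu> \<in> Linf_dual \<Omega> \<times> Linf_dual \<Omega>" "dual_pair_nonneg \<Omega> \<mu>"
    and lin: "linear_op \<Omega> A" "linear_op \<Omega> S" "linear_op \<Omega> T"
    and le: "op_le \<Omega> S A" "op_le \<Omega> A T"
    and u: "u \<in> L1 \<Omega>" "ae_le \<Omega> (\<lambda>_. 0) u"
  shows "dual_pairing \<mu> (bound_op S T u) \<le> dual_pairing \<mu> (bound_op A A u)"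
proof -
  have L: "A u \<in> Linf \<Omega>" "S u \<in> Linf \<Omega>" "T u \<in> Linf \<Omega>" using lin u by (auto simp: linear_op_def)
  have "0 * mass \<mu> \<le> dual_pairing \<mu> (bound_op A A u - bound_op S T u)"
  proof (rule dual_pairing_const_bounds(2)[OF mu])
    have "ae_le \<Omega> (\<lambda>_. 0) (A u - S u)" "ae_le \<Omega> (\<lambda>_. 0) (T u - A u)"
      using le u by (auto simp: op_le_def)
    then show "pair_le \<Omega> (const_pair 0) (bound_op A A u - bound_op S T u)"
      by (simp add: pair_le_def const_pair_def bound_op_def ae_le_def)
  qed (use L Linf_diff[of "A u" \<Omega> "S u"] Linf_diff[of "T u" \<Omega> "A u"] in
      \<open>simp_all add: bound_op_def fun_diff_def\<close>)
  also have "\<dots> = dual_pairing \<mu> (bound_op A A u) - dual_pairing \<mu> (bound_op S T u)"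
    using bound_op_Linf[OF lin(1,1) u(1)] bound_op_Linf[OF lin(2,3) u(1)]
    by (intro dual_pairing_diff[OF mu(1)])
  finally show ?thesis by simp
qed

lemma bound_op_close:
  assumes mu: "\<mu> \<in> Linf_dual \<Omega> \<times> Linf_dual \<Omega>" "dual_pair_nonneg \<Omega> \<mu>"
    and lin: "linear_op \<Omega> A" "linear_op \<Omega> S" "linear_op \<Omega> T"
    and norm: "op_pair_norm \<Omega> (\<lambda>u. bound_op A A u - bound_op S T u) \<le> ennreal K" and K: "0 \<le> K"
    and u: "u \<in> L1 \<Omega>"
  shows "dual_pairing \<mu> (bound_op A A u) - dual_pairing \<mu> (bound_op S T u)
    \<le> mass \<mu> * K * (\<integral>x. \<bar>u x\<bar> \<partial>lebesgue_on \<Omega>)"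
proof -
  have L: "A u \<in> Linf \<Omega>" "S u \<in> Linf \<Omega>" "T u \<in> Linf \<Omega>" using lin u by (auto simp: linear_op_def)
  have diff: "bound_op A A v - bound_op S T v = (A v - S v, T v - A v)" for v
    by (simp add: bound_op_def fun_eq_iff)
  have "max (Linf_norm \<Omega> (A v - S v)) (Linf_norm \<Omega> (T v - A v)) \<le> ennreal K"
    if "v \<in> L1 \<Omega>" "L1_norm \<Omega> v \<le> 1" for v
    using norm that unfolding op_pair_norm_def SUP_le_iff by (auto simp: diff Linf_pair_norm_def)
  then have AE: "AE x in lebesgue_on \<Omega>. \<bar>(A u - S u) x\<bar> \<le> K * (\<integral>x. \<bar>u x\<bar> \<partial>lebesgue_on \<Omega>)"
    "AE x in lebesgue_on \<Omega>. \<bar>(T u - A u) x\<bar> \<le> K * (\<integral>x. \<bar>u x\<bar> \<partial>lebesgue_on \<Omega>)"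
    by (intro linear_op_AE_bound[OF linear_op_diff K _ u] lin; simp)+
  have "dual_pairing \<mu> (bound_op A A u) - dual_pairing \<mu> (bound_op S T u)
      = dual_pairing \<mu> (bound_op A A u - bound_op S T u)"
    using bound_op_Linf[OF lin(1,1) u(1)] bound_op_Linf[OF lin(2,3) u(1)]
    by (intro dual_pairing_diff[OF mu(1), symmetric])
  also have "\<dots> \<le> (K * (\<integral>x. \<bar>u x\<bar> \<partial>lebesgue_on \<Omega>)) * mass \<mu>"
    unfolding diff
  proof (rule dual_pairing_const_bounds(1)[OF mu])
    show "pair_le \<Omega> (A u - S u, T u - A u) (const_pair (K * (\<integral>x. \<bar>u x\<bar> \<partial>lebesgue_on \<Omega>)))"
      using AE by (auto simp: pair_le_def const_pair_def ae_le_def elim: eventually_mono)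
  qed (use L Linf_diff[of "A u" \<Omega> "S u"] Linf_diff[of "T u" \<Omega> "A u"] in
      \<open>simp_all add: fun_diff_def\<close>)
  finally show ?thesis by (simp add: mult_ac)
qed

section \<open>Estimates for the dual problem\<close>

text \<open>
  If the ball of radius \<open>r\<close> lies in the subdifferential at 0, testing with the multiple
  \<open>r / 2 * sgn v\<close>, which attains the duality between \<open>L\<^sup>1\<close> and \<open>L\<^sup>\<infinity>\<close>, bounds \<open>J v\<close> from below by a
  multiple of the \<open>L\<^sup>1\<close> norm. The factor \<open>1/2\<close> keeps the test function inside the open ball.
\<close>

lemma interior_coercive:
  assumes "nonempty_interior_assumption \<Omega> J"
  obtains \<rho> where "0 < \<rho>"
    "\<And>v. v \<in> L1 \<Omega> \<Longrightarrow> ereal (\<rho> * (\<integral>x. \<bar>v x\<bar> \<partial>lebesgue_on \<Omega>)) \<le> J v"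
proof -
  obtain r where r: "0 < r" "{p \<in> Linf \<Omega>. Linf_norm \<Omega> p < ennreal r} \<subseteq> subdiff \<Omega> J (\<lambda>_. 0)"
    using assms unfolding nonempty_interior_assumption_def by blast
  show ?thesis
  proof (rule that[of "r / 2"])
    show "0 < r / 2" using r by simp
    fix v assume v: "v \<in> L1 \<Omega>"
    define q where "q x = r / 2 * sgn (v x)" for x
    have [measurable]: "v \<in> borel_measurable (lebesgue_on \<Omega>)" using v by (auto simp: L1_def)
    have q: "q \<in> borel_measurable (lebesgue_on \<Omega>)" "AE x in lebesgue_on \<Omega>. \<bar>q x\<bar> \<le> r / 2"
      using r(1) by (auto simp: q_def[abs_def] abs_mult sgn_if)
    have "Linf_norm \<Omega> q \<le> ennreal (r / 2)" by (rule Linf_norm_le[OF q])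
    also have "\<dots> < ennreal r" using r(1) by (simp add: ennreal_less_iff)
    finally have "q \<in> subdiff \<Omega> J (\<lambda>_. 0)" using r(2) Linf_I[OF q] by auto
    then have "ereal (pairing \<Omega> q v) \<le> J v" using v by (simp add: subdiff_def)
    moreover have "pairing \<Omega> q v = (\<integral>x. r / 2 * \<bar>v x\<bar> \<partial>lebesgue_on \<Omega>)"
      unfolding pairing_def
      by (intro Bochner_Integration.integral_cong) (auto simp: q_def abs_sgn mult_ac)
    ultimately show "ereal (r / 2 * (\<integral>x. \<bar>v x\<bar> \<partial>lebesgue_on \<Omega>)) \<le> J v" by simp
  qed
qed

text \<open>
  Weak duality, the only way in which feasibility enters the estimates. With \<open>u\<close> the exact solution it
  bounds \<open>\<mu>\<close>, and with \<open>u\<close> the constant 1 it bounds the integral of \<open>lam\<close>.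
\<close>

lemma dual_feasible_le:
  assumes fin: "finite_measure (lebesgue_on \<Omega>)"
    and T: "regular_op \<Omega> S" "regular_op \<Omega> T"
    and feas: "dual_feasible \<Omega> J (bound_op S T) lam \<mu>" and u: "u \<in> L1 \<Omega>"
  shows "ereal (pairing \<Omega> lam u - dual_pairing \<mu> (bound_op S T u)) \<le> J u"
proof -
  have *: "lam \<in> Linf \<Omega>" "\<mu> \<in> Linf_dual \<Omega> \<times> Linf_dual \<Omega>" "dual_pair_nonneg \<Omega> \<mu>"
    "lam - adjoint_op \<Omega> (bound_op S T) \<mu> \<in> subdiff \<Omega> J (\<lambda>_. 0)"
    using feas by (auto simp: dual_feasible_def)
  have "ereal (pairing \<Omega> (lam - adjoint_op \<Omega> (bound_op S T) \<mu>) u) \<le> J u"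
    using *(4) u by (simp add: subdiff_def)
  then show ?thesis
    by (simp add: pairing_diff[OF *(1) _ u] adjoint_op_bound_op[OF fin *(2,3) T] u)
qed

text \<open>
  The multiplier \<open>\<mu>\<close> of the source condition is feasible for the exact operator, but replacing that
  operator by its bounds perturbs the adjoint by up to \<open>mass \<mu> * K\<close> in the \<open>L\<^sup>\<infinity>\<close> norm. Coercivity
  absorbs a perturbation of size \<open>mass \<mu> * K\<close> at the price of adding \<open>mass \<mu> * K / \<rho>\<close> times \<open>J\<close>, so
  shrinking by \<open>c = 1 / (1 + mass \<mu> * K / \<rho>)\<close> restores feasibility.
\<close>

lemma scaled_multiplier_feasible:
  assumes fin: "finite_measure (lebesgue_on \<Omega>)"
    and A: "linear_op \<Omega> A"
    and T: "regular_op \<Omega> S" "regular_op \<Omega> T" "op_le \<Omega> S A"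
    and norm: "op_pair_norm \<Omega> (\<lambda>u. bound_op A A u - bound_op S T u) \<le> ennreal K" and K: "0 \<le> K"
    and mu: "\<mu> \<in> Linf_dual \<Omega> \<times> Linf_dual \<Omega>" "dual_pair_nonneg \<Omega> \<mu>"
    and source: "- adjoint_op \<Omega> (bound_op A A) \<mu> \<in> subdiff \<Omega> J ubar"
    and J: "L1_functional \<Omega> J" "abs_one_homogeneous \<Omega> J"
    and \<rho>: "0 < \<rho>" "\<And>v. v \<in> L1 \<Omega> \<Longrightarrow> ereal (\<rho> * (\<integral>x. \<bar>v x\<bar> \<partial>lebesgue_on \<Omega>)) \<le> J v"
  defines "c \<equiv> \<rho> / (\<rho> + mass \<mu> * K)"
  shows "dual_feasible \<Omega> J (bound_op S T) (\<lambda>_. 0) (\<lambda>\<psi>. c * fst \<mu> \<psi>, \<lambda>\<psi>. c * snd \<mu> \<psi>)"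
    (is "dual_feasible _ _ _ _ ?\<mu>")
proof -
  have mK: "0 \<le> mass \<mu> * K" using mass_nonneg[OF mu(2)] K by simp
  then have den: "0 < \<rho> + mass \<mu> * K" using \<rho>(1) by (rule add_pos_nonneg[rotated])
  then have "c * (\<rho> + mass \<mu> * K) = \<rho>" by (simp add: c_def)
  then have c: "0 \<le> c" "c * \<rho> + c * (mass \<mu> * K) = \<rho>"
    using \<rho>(1) den by (simp_all add: c_def distrib_left)
  have dual: "(\<lambda>\<psi>. c * \<nu> \<psi>) \<in> Linf_dual \<Omega>" if nu: "\<nu> \<in> Linf_dual \<Omega>" for \<nu>
  proof -
    obtain d where d: "\<forall>\<psi>\<in>Linf \<Omega>. \<bar>\<nu> \<psi>\<bar> \<le> d * enn2real (Linf_norm \<Omega> \<psi>)"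
      using nu unfolding Linf_dual_def by blast
    have "\<forall>\<psi>\<in>Linf \<Omega>. \<bar>c * \<nu> \<psi>\<bar> \<le> (c * d) * enn2real (Linf_norm \<Omega> \<psi>)"
      using d c(1) by (auto simp: abs_mult mult.assoc intro: mult_left_mono)
    moreover have "c * \<nu> (\<lambda>x. a * \<psi> x + b * \<psi>' x) = a * (c * \<nu> \<psi>) + b * (c * \<nu> \<psi>')"
      if "\<psi> \<in> Linf \<Omega>" "\<psi>' \<in> Linf \<Omega>" for \<psi> \<psi>' a b
      using Linf_dual_lin[OF nu that] by (simp add: algebra_simps)
    ultimately show ?thesis unfolding Linf_dual_def by blast
  qed
  have mu': "?\<mu> \<in> Linf_dual \<Omega> \<times> Linf_dual \<Omega>" "dual_pair_nonneg \<Omega> ?\<mu>"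
    using mu c(1) dual by (auto simp: dual_pair_nonneg_def dual_nonneg_def)
  have pair': "dual_pairing ?\<mu> \<psi> = c * dual_pairing \<mu> \<psi>" for \<psi>
    by (simp add: dual_pairing_def distrib_left)
  have Areg: "regular_op \<Omega> A" by (rule regular_op_above[OF A T(1,3)])
  let ?w = "adjoint_op \<Omega> (bound_op S T) ?\<mu>"
  note w = adjoint_op_bound_op[OF fin mu' T(1,2)]
  have "J v \<ge> ereal (pairing \<Omega> (- ?w) v)" if v: "v \<in> L1 \<Omega>" for v
  proof (cases "J v")
    case (real j)
    define t where "t = (\<integral>x. \<bar>v x\<bar> \<partial>lebesgue_on \<Omega>)"
    have "pairing \<Omega> (- adjoint_op \<Omega> (bound_op A A) \<mu>) v \<le> j"
      using source v real by (auto simp: subdiff_def dest!: bspec[of _ _ v])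
    then have 1: "- dual_pairing \<mu> (bound_op A A v) \<le> j"
      by (simp add: pairing_uminus adjoint_op_bound_op[OF fin mu Areg Areg] v)
    have 2: "dual_pairing \<mu> (bound_op A A v) - dual_pairing \<mu> (bound_op S T v) \<le> mass \<mu> * K * t"
      unfolding t_def using T
      by (intro bound_op_close[OF mu A _ _ norm K v]) (auto simp: regular_op_def)
    have 3: "\<rho> * t \<le> j" using \<rho>(2)[OF v] real by (simp add: t_def)
    have "- dual_pairing \<mu> (bound_op S T v) \<le> j + mass \<mu> * K * t" using 1 2 by linarith
    then have "\<rho> * (c * - dual_pairing \<mu> (bound_op S T v)) \<le> \<rho> * (c * (j + mass \<mu> * K * t))"
      using c(1) \<rho>(1) by (intro mult_left_mono) auto
    also have "\<dots> = c * \<rho> * j + c * (mass \<mu> * K) * (\<rho> * t)" by (simp add: algebra_simps)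
    also have "\<dots> \<le> c * \<rho> * j + c * (mass \<mu> * K) * j"
      using 3 c(1) mK by (intro add_left_mono mult_left_mono) auto
    also have "\<dots> = \<rho> * j" using c(2) by (metis distrib_right)
    finally have "c * - dual_pairing \<mu> (bound_op S T v) \<le> j"
      using \<rho>(1) by (simp only: mult_le_cancel_left_pos)
    then show ?thesis
      unfolding pairing_uminus w(2)[OF v] pair' real by simp
  next
    case MInf
    then show ?thesis using J(1) v by (auto simp: L1_functional_def)
  qed simp
  moreover have "J (\<lambda>_. 0) = ereal (pairing \<Omega> (- ?w) (\<lambda>_. 0))"
  proof -
    have "(\<lambda>_. 0) \<in> L1 \<Omega>" by (simp add: L1_def)
    from J(2)[unfolded abs_one_homogeneous_def, rule_format, OF this, of 0]
    show ?thesis by (simp add: pairing_def zero_ereal_def[symmetric])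
  qed
  moreover have "- ?w \<in> Linf \<Omega>" using Linf_uminus[OF w(1)] by (simp add: fun_Compl_def)
  ultimately have "- ?w \<in> subdiff \<Omega> J (\<lambda>_. 0)" by (simp add: subdiff_def)
  moreover have "(\<lambda>_. 0) - ?w = - ?w" by (simp add: fun_eq_iff)
  ultimately show ?thesis
    using mu' Linf_const[of 0 \<Omega>] by (simp add: dual_feasible_def ae_le_def)
qed

text \<open>
  Optimality of \<open>\<mu>\<close> against the competitor \<open>c \<mu>bar\<close> gives \<open>(\<mu>, \<phi>) \<le> c (\<mu>bar, \<phi>)\<close>. On the left,
  \<open>\<phi>\<close> exceeds the exact data by at least \<open>\<epsilon>\<close>, and weak duality at \<open>ubar\<close> bounds the pairing with the
  exact data below by \<open>- J ubar\<close>; so the left side is at least \<open>\<epsilon> mass \<mu> - J ubar\<close>. On the right,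
  the source condition makes the pairing of \<open>\<mu>bar\<close> with the exact data equal to \<open>- J ubar\<close>, up to an
  error \<open>C0 \<epsilon> mass \<mu>bar\<close>. The two copies of \<open>J ubar\<close> cancel except for the fraction \<open>1 - c\<close>, which
  is of order \<open>\<eta>\<close>. What is left is of order \<open>\<epsilon> + \<eta>\<close>, and dividing by \<open>\<epsilon>\<close> gives the bound.
\<close>

lemma dual_solution_mass_bound:
  assumes fin: "finite_measure (lebesgue_on \<Omega>)"
    and A: "linear_op \<Omega> A"
    and T: "regular_op \<Omega> S" "regular_op \<Omega> T" "op_le \<Omega> S A" "op_le \<Omega> A T"
    and norm: "op_pair_norm \<Omega> (\<lambda>u. bound_op A A u - bound_op S T u) \<le> ennreal \<eta>" and \<eta>: "0 \<le> \<eta>"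
    and mubar: "\<mu>bar \<in> Linf_dual \<Omega> \<times> Linf_dual \<Omega>" "dual_pair_nonneg \<Omega> \<mu>bar"
    and source: "- adjoint_op \<Omega> (bound_op A A) \<mu>bar \<in> subdiff \<Omega> J ubar"
    and J: "L1_functional \<Omega> J" "abs_one_homogeneous \<Omega> J"
    and \<rho>: "0 < \<rho>" "\<And>v. v \<in> L1 \<Omega> \<Longrightarrow> ereal (\<rho> * (\<integral>x. \<bar>v x\<bar> \<partial>lebesgue_on \<Omega>)) \<le> J v"
    and ubar: "nonneg_solution \<Omega> A f ubar" and j: "J ubar = ereal j"
    and f: "f \<in> Linf \<Omega>" "fl \<in> Linf \<Omega>" "fu \<in> Linf \<Omega>"
    and lower: "pair_le \<Omega> (const_pair \<epsilon>) (bound_rhs fl fu - bound_rhs f f)"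
    and upper: "pair_le \<Omega> (bound_rhs fl fu - bound_rhs f f) (const_pair (C0 * \<epsilon>))"
    and \<epsilon>: "0 < \<epsilon>" and C0: "0 \<le> C0"
    and sol: "dual_solution \<Omega> J (bound_op S T) (bound_rhs fl fu) lam \<mu>"
  shows "mass \<mu> \<le> mass \<mu>bar * (\<eta> / \<epsilon> * j / \<rho> + C0)"
proof -
  let ?\<phi> = "bound_rhs fl fu" and ?\<phi>bar = "bound_rhs f f"
  define c where "c = \<rho> / (\<rho> + mass \<mu>bar * \<eta>)"
  have m0: "0 \<le> mass \<mu>bar" by (rule mass_nonneg[OF mubar(2)])
  have den: "0 < \<rho> + mass \<mu>bar * \<eta>" using \<rho>(1) m0 \<eta> by (intro add_pos_nonneg) auto
  have c: "0 \<le> c" "c \<le> 1" using den \<rho>(1) m0 \<eta> by (auto simp: c_def field_simps)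
  have "1 - c = mass \<mu>bar * \<eta> / (\<rho> + mass \<mu>bar * \<eta>)"
    using den by (simp add: c_def field_simps)
  also have "\<dots> \<le> mass \<mu>bar * \<eta> / \<rho>"
    using \<rho>(1) m0 \<eta> by (intro divide_left_mono) (auto intro!: mult_pos_pos den)
  finally have c1: "1 - c \<le> mass \<mu>bar * \<eta> / \<rho>" .
  have u: "ubar \<in> L1 \<Omega>" "ae_le \<Omega> (\<lambda>_. 0) ubar" "ae_eq \<Omega> (A ubar) f"
    using ubar by (auto simp: nonneg_solution_def)
  have lin: "linear_op \<Omega> S" "linear_op \<Omega> T" using T by (auto simp: regular_op_def)
  have Areg: "regular_op \<Omega> A" by (rule regular_op_above[OF A T(1,3)])
  have feas: "dual_feasible \<Omega> J (bound_op S T) lam \<mu>" using sol by (simp add: dual_solution_def)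
  then have mu: "\<mu> \<in> Linf_dual \<Omega> \<times> Linf_dual \<Omega>" "dual_pair_nonneg \<Omega> \<mu>" and lam: "ae_le \<Omega> (\<lambda>_. 0) lam"
    by (auto simp: dual_feasible_def)
  have phiL: "fst ?\<phi> \<in> Linf \<Omega>" "snd ?\<phi> \<in> Linf \<Omega>" "fst ?\<phi>bar \<in> Linf \<Omega>" "snd ?\<phi>bar \<in> Linf \<Omega>"
    "fst (?\<phi> - ?\<phi>bar) \<in> Linf \<Omega>" "snd (?\<phi> - ?\<phi>bar) \<in> Linf \<Omega>"
    using f Linf_uminus[of fl \<Omega>] Linf_uminus[of f \<Omega>] Linf_diff[of fu \<Omega> f] Linf_diff[of f \<Omega> fl]
    by (simp_all add: bound_rhs_def fun_Compl_def fun_diff_def)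
  have j0: "0 \<le> j" using J(1) u(1) j by (auto simp: L1_functional_def dest!: bspec[of _ _ ubar])
  \<comment> \<open>On the solution \<open>ubar\<close>, the exact operator may be exchanged for the exact data.\<close>
  have exact: "dual_pairing \<nu> (bound_op A A ubar) = dual_pairing \<nu> ?\<phi>bar"
    if nu: "\<nu> \<in> Linf_dual \<Omega> \<times> Linf_dual \<Omega>" "dual_pair_nonneg \<Omega> \<nu>" for \<nu>
  proof -
    have L: "A ubar \<in> Linf \<Omega>" using A u(1) by (auto simp: linear_op_def)
    have "fst \<nu> (A ubar) = fst \<nu> f"
      using nu by (intro dual_nonneg_cong[OF _ _ L f(1) u(3)]) (auto simp: dual_pair_nonneg_def)
    moreover have "snd \<nu> (- A ubar) = snd \<nu> (- f)"
      using nu u(3) Linf_uminus[OF L] Linf_uminus[OF f(1)]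
      by (intro dual_nonneg_cong) (auto simp: dual_pair_nonneg_def fun_Compl_def ae_eq_def)
    ultimately show ?thesis by (simp add: dual_pairing_def bound_op_def bound_rhs_def)
  qed
  have "0 \<le> pairing \<Omega> lam ubar"
    unfolding pairing_def
  proof (rule integral_nonneg_AE)
    show "AE x in lebesgue_on \<Omega>. 0 \<le> lam x * ubar x"
      using lam u(2) unfolding ae_le_def by eventually_elim simp
  qed
  then have "- j \<le> dual_pairing \<mu> (bound_op S T ubar)"
    using dual_feasible_le[OF fin T(1,2) feas u(1)] j by simp
  also have "\<dots> \<le> dual_pairing \<mu> (bound_op A A ubar)"
    by (rule bound_op_mono[OF mu A lin T(3,4) u(1,2)])
  finally have low1: "- j \<le> dual_pairing \<mu> ?\<phi>bar" by (simp add: exact[OF mu])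
  have low2: "\<epsilon> * mass \<mu> \<le> dual_pairing \<mu> ?\<phi> - dual_pairing \<mu> ?\<phi>bar"
    using dual_pairing_const_bounds(2)[OF mu phiL(5,6) lower]
      dual_pairing_diff[OF mu(1) phiL(1-4)] by simp
  have "j = pairing \<Omega> (- adjoint_op \<Omega> (bound_op A A) \<mu>bar) ubar"
    using source j by (simp add: subdiff_def)
  also have "\<dots> = - dual_pairing \<mu>bar (bound_op A A ubar)"
    by (simp add: pairing_uminus adjoint_op_bound_op[OF fin mubar Areg Areg] u(1))
  finally have bar: "dual_pairing \<mu>bar ?\<phi>bar = - j" by (simp add: exact[OF mubar])
  have up: "dual_pairing \<mu>bar ?\<phi> - dual_pairing \<mu>bar ?\<phi>bar \<le> C0 * \<epsilon> * mass \<mu>bar"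
    using dual_pairing_const_bounds(1)[OF mubar phiL(5,6) upper]
      dual_pairing_diff[OF mubar(1) phiL(1-4)] by simp
  let ?\<mu>' = "(\<lambda>\<psi>. c * fst \<mu>bar \<psi>, \<lambda>\<psi>. c * snd \<mu>bar \<psi>)"
  have "dual_feasible \<Omega> J (bound_op S T) (\<lambda>_. 0) ?\<mu>'"
    unfolding c_def by (rule scaled_multiplier_feasible[OF fin A T(1-3) norm \<eta> mubar source J \<rho>])
  then have "dual_pairing ?\<mu>' (- ?\<phi>) \<le> dual_pairing \<mu> (- ?\<phi>)"
    using sol by (simp add: dual_solution_def)
  moreover have "dual_pairing ?\<mu>' (- ?\<phi>) = c * dual_pairing \<mu>bar (- ?\<phi>)"
    by (simp add: dual_pairing_def distrib_left)
  ultimately have "dual_pairing \<mu> ?\<phi> \<le> c * dual_pairing \<mu>bar ?\<phi>"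
    by (simp add: dual_pairing_uminus[OF mu(1) phiL(1,2)] dual_pairing_uminus[OF mubar(1) phiL(1,2)])
  also have "\<dots> \<le> c * (C0 * \<epsilon> * mass \<mu>bar - j)"
    using up bar c(1) by (intro mult_left_mono) auto
  finally have "\<epsilon> * mass \<mu> \<le> (1 - c) * j + c * (C0 * \<epsilon> * mass \<mu>bar)"
    using low1 low2 by (simp add: algebra_simps)
  also have "\<dots> \<le> mass \<mu>bar * \<eta> / \<rho> * j + 1 * (C0 * \<epsilon> * mass \<mu>bar)"
    using c1 c(2) j0 m0 \<epsilon> C0 by (intro add_mono mult_right_mono) auto
  also have "\<dots> = \<epsilon> * (mass \<mu>bar * (\<eta> / \<epsilon> * j / \<rho> + C0))"
    using \<epsilon> \<rho>(1) by (simp add: field_simps)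
  finally show ?thesis using \<epsilon> by simp
qed

lemma bounded_above_of_limsup_less_top:
  fixes a :: "nat \<Rightarrow> real"
  assumes "limsup (\<lambda>n. ereal (a n)) \<le> ereal D"
  obtains H where "\<And>n. a n \<le> H"
proof -
  have "limsup (\<lambda>n. ereal (a n)) < ereal (D + 1)"
    using assms by (rule le_less_trans) simp
  then have "\<forall>\<^sub>F n in sequentially. ereal (a n) < ereal (D + 1)" by (rule Limsup_lessD)
  then obtain N where N: "\<And>n. n \<ge> N \<Longrightarrow> a n < D + 1"
    by (auto simp: eventually_sequentially)
  have "a n \<le> max (D + 1) (Max (a ` {..N}))" for n
  proof (cases "n \<ge> N")
    case False
    then have "a n \<le> Max (a ` {..N})" by (intro Max_ge) auto
    then show ?thesis by simp
  qed (use N[of n] in simp)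
  then show ?thesis by (rule that)
qed

theorem proposition14:
  fixes \<Omega> :: "(real ^ 'm) set"
    and A :: "'m fn \<Rightarrow> 'm fn" and f :: "'m fn"
    and Al Au :: "nat \<Rightarrow> 'm fn \<Rightarrow> 'm fn" and fl fu :: "nat \<Rightarrow> 'm fn"
    and J :: "'m fn \<Rightarrow> ereal" and ubar :: "'m fn"
    and lam :: "nat \<Rightarrow> 'm fn" and \<mu> :: "nat \<Rightarrow> 'm functional \<times> 'm functional"
  defines "B \<equiv> \<lambda>n. bound_op (Al n) (Au n)"
    and "Bbar \<equiv> bound_op A A"
    and "\<phi> \<equiv> \<lambda>n. bound_rhs (fl n) (fu n)"
    and "\<phi>bar \<equiv> bound_rhs f f"
  assumes "domain_set \<Omega>" and "bounded \<Omega>"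
    and "linear_op \<Omega> A" and "f \<in> Linf \<Omega>"
    and "rhs_bounds \<Omega> f fl fu" and "op_bounds \<Omega> A Al Au"
    and "L1_functional \<Omega> J" and "convex_functional \<Omega> J"
    and "proper_functional \<Omega> J" and "abs_one_homogeneous \<Omega> J"
    and "\<exists>u. nonneg_solution \<Omega> A f u \<and> J u < \<infinity>"
    and "J_minimising_solution \<Omega> J A f ubar"
    and "J (\<lambda>_. 1) < \<infinity>"
    and "convergence_assumption \<Omega> Bbar B \<phi>bar \<phi>"
    and "source_condition \<Omega> J Bbar ubar"
    and "nonempty_interior_assumption \<Omega> J"
    and "\<And>n. dual_solution \<Omega> J (B n) (\<phi> n) (lam n) (\<mu> n)"
  shows "\<exists>C\<ge>0. \<forall>n. L1_norm \<Omega> (lam n) \<le> ennreal C"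
proof -
  note A = \<open>linear_op \<Omega> A\<close> and f = \<open>f \<in> Linf \<Omega>\<close>
    and J = \<open>L1_functional \<Omega> J\<close> \<open>abs_one_homogeneous \<Omega> J\<close>
    and sol = \<open>\<And>n. dual_solution \<Omega> J (B n) (\<phi> n) (lam n) (\<mu> n)\<close>[unfolded B_def \<phi>_def]
  have fin: "finite_measure (lebesgue_on \<Omega>)"
    by (rule finite_measure_lebesgue_on_bounded) fact+
  have F: "fl n \<in> Linf \<Omega>" "fu n \<in> Linf \<Omega>" for n
    using \<open>rhs_bounds \<Omega> f fl fu\<close> by (auto simp: rhs_bounds_def)
  have T: "regular_op \<Omega> (Al n)" "regular_op \<Omega> (Au n)" "op_le \<Omega> (Al n) A" "op_le \<Omega> A (Au n)" for n
    using \<open>op_bounds \<Omega> A Al Au\<close> by (auto simp: op_bounds_def)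
  have ubar: "nonneg_solution \<Omega> A f ubar"
    using \<open>J_minimising_solution \<Omega> J A f ubar\<close> by (simp add: J_minimising_solution_def)
  obtain \<mu>bar where mubar: "\<mu>bar \<in> Linf_dual \<Omega> \<times> Linf_dual \<Omega>" "dual_pair_nonneg \<Omega> \<mu>bar"
    and source: "- adjoint_op \<Omega> (bound_op A A) \<mu>bar \<in> subdiff \<Omega> J ubar"
    using \<open>source_condition \<Omega> J Bbar ubar\<close> unfolding source_condition_def Bbar_def by blast
  obtain j where j: "J ubar = ereal j" using source by (auto simp: subdiff_def)
  have j0: "0 \<le> j"
    using J(1) ubar j by (auto simp: L1_functional_def nonneg_solution_def dest!: bspec[of _ _ ubar])
  obtain \<rho> where \<rho>: "0 < \<rho>"
    "\<And>v. v \<in> L1 \<Omega> \<Longrightarrow> ereal (\<rho> * (\<integral>x. \<bar>v x\<bar> \<partial>lebesgue_on \<Omega>)) \<le> J v"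
    using interior_coercive[OF \<open>nonempty_interior_assumption \<Omega> J\<close>] by blast
  obtain \<epsilon> \<eta> C0 D0 where \<epsilon>: "\<And>n. 0 < \<epsilon> n" and \<eta>: "decseq \<eta>" "\<eta> \<longlonglongrightarrow> 0" and C0: "1 \<le> C0"
    and bounds: "\<And>n. pair_le \<Omega> (const_pair (\<epsilon> n)) (bound_rhs (fl n) (fu n) - bound_rhs f f)"
      "\<And>n. pair_le \<Omega> (bound_rhs (fl n) (fu n) - bound_rhs f f) (const_pair (C0 * \<epsilon> n))"
    and norm: "\<And>n. op_pair_norm \<Omega> (\<lambda>u. bound_op A A u - bound_op (Al n) (Au n) u) \<le> ennreal (\<eta> n)"
    and ratio: "limsup (\<lambda>n. ereal (\<eta> n / \<epsilon> n)) \<le> ereal D0"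
    using \<open>convergence_assumption \<Omega> Bbar B \<phi>bar \<phi>\<close>
    unfolding convergence_assumption_def B_def Bbar_def \<phi>_def \<phi>bar_def by blast
  have \<eta>0: "0 \<le> \<eta> n" for n using decseq_ge[OF \<eta>] .
  obtain H where H: "\<And>n. \<eta> n / \<epsilon> n \<le> H"
    using bounded_above_of_limsup_less_top[OF ratio] by blast
  \<comment> \<open>A single bound on all total masses: the estimate depends on \<open>n\<close> only through \<open>\<eta> n / \<epsilon> n\<close>.\<close>
  define m where "m = mass \<mu>bar * (H * j / \<rho> + C0)"
  have mass: "mass (\<mu> n) \<le> m" for n
  proof -
    have "mass (\<mu> n) \<le> mass \<mu>bar * (\<eta> n / \<epsilon> n * j / \<rho> + C0)"
      using C0 by (intro dual_solution_mass_bound[OF fin A T norm \<eta>0 mubar source J \<rho> ubar j f F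
          bounds \<epsilon> _ sol]) auto
    also have "\<dots> \<le> m"
      unfolding m_def using mass_nonneg[OF mubar(2)] j0 \<rho>(1) H
      by (intro mult_left_mono add_right_mono divide_right_mono mult_right_mono) auto
    finally show ?thesis .
  qed
  have one: "(\<lambda>_. 1) \<in> L1 \<Omega>"
    using finite_measure.integrable_const[OF fin] by (simp add: L1_def)
  have "J (\<lambda>_. 1) \<noteq> - \<infinity>" using J(1) one by (auto simp: L1_functional_def)
  with \<open>J (\<lambda>_. 1) < \<infinity>\<close> obtain j1 where j1: "J (\<lambda>_. 1) = ereal j1" by (cases "J (\<lambda>_. 1)") auto
  \<comment> \<open>For the constant 1, the operator bounds can be replaced by the exact operator, independent of \<open>n\<close>.\<close>
  have AL: "A (\<lambda>_. 1) \<in> Linf \<Omega>" using A one by (auto simp: linear_op_def)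
  then obtain a where a: "0 \<le> a" "AE x in lebesgue_on \<Omega>. \<bar>A (\<lambda>_. 1) x\<bar> \<le> a" by (elim Linf_E)
  have "L1_norm \<Omega> (lam n) \<le> ennreal (j1 + a * m)" for n
  proof -
    have feas: "dual_feasible \<Omega> J (bound_op (Al n) (Au n)) (lam n) (\<mu> n)"
      using sol[of n] by (simp add: dual_solution_def)
    then have mu: "\<mu> n \<in> Linf_dual \<Omega> \<times> Linf_dual \<Omega>" "dual_pair_nonneg \<Omega> (\<mu> n)"
      and lam: "lam n \<in> Linf \<Omega>" "ae_le \<Omega> (\<lambda>_. 0) (lam n)"
      by (auto simp: dual_feasible_def)
    have "pairing \<Omega> (lam n) (\<lambda>_. 1) \<le> j1 + dual_pairing (\<mu> n) (bound_op (Al n) (Au n) (\<lambda>_. 1))"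
      using dual_feasible_le[OF fin T(1,2) feas one] j1 by simp
    also have "dual_pairing (\<mu> n) (bound_op (Al n) (Au n) (\<lambda>_. 1))
        \<le> dual_pairing (\<mu> n) (bound_op A A (\<lambda>_. 1))"
      using T(1,2)[of n]
      by (intro bound_op_mono[OF mu A _ _ T(3,4) one]) (auto simp: ae_le_def regular_op_def)
    also have "\<dots> \<le> a * mass (\<mu> n)"
      using a(2)
      by (intro dual_pairing_const_bounds(1)[OF mu] bound_op_Linf[OF A A one])
        (auto simp: pair_le_def const_pair_def bound_op_def ae_le_def elim: eventually_mono)
    also have "\<dots> \<le> a * m" using mass a(1) by (rule mult_left_mono)
    finally have "pairing \<Omega> (lam n) (\<lambda>_. 1) \<le> j1 + a * m" by simp
    moreover have "lam n \<in> L1 \<Omega>"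
      using Linf_times_L1_integrable[OF lam(1) one] by (simp add: L1_def)
    moreover have "(\<integral>x. \<bar>lam n x\<bar> \<partial>lebesgue_on \<Omega>) = pairing \<Omega> (lam n) (\<lambda>_. 1)"
      unfolding pairing_def using lam calculation(2)
      by (intro integral_cong_AE) (auto simp: ae_le_def L1_def elim: eventually_mono)
    ultimately show ?thesis by (simp add: L1_norm_eq ennreal_leI)
  qed
  then have "L1_norm \<Omega> (lam n) \<le> ennreal (max 0 (j1 + a * m))" for n
    by (rule order_trans) (simp add: ennreal_leI)
  then show ?thesis by (intro exI[of _ "max 0 (j1 + a * m)"]) simp
qed

end
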